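(* Let $k\ge 1$ be an integer. Then, uniformly for $a_1,\dots,a_k\in\mathbb{C}$ in bounded sets, $$\lim_{N\to\infty}\mathbb{E}_N\left[\prod_{r=1}^k Z\left(\theta_N+\frac{a_r}{N}\right)\right]=\sum_{m=0}^\infty\frac{(-1)^m i^{k+m}}{(m+k+1)!}\,h_m(a_1,\dots,a_k)\prod_{j=1}^k a_j,$$ where $h_m(a_1,\dots,a_k)$ is the complete homogeneous symmetric polynomial of degree $m$ in $k$ variables.
   Context: For an $N\times N$ unitary matrix with eigenvalues $e^{i\theta_1},\dots,e^{i\theta_N}$, the characteristic polynomial is $Z(\theta)=\prod_{m=1}^N\left(1-e^{i\theta_m}e^{-i\theta}\right)$, viewed as an entire function of $\theta\in\mathbb{C}$. $\mathbb{E}_N$ denotes expectation over Haar measure on the $N\times N$ unitary group; in terms of the eigenphases $(\theta_1,\dots,\theta_N)\in[-\pi,\pi)^N$ (unordered, so that $\theta_N$ is simply the last coordinate) this is integration against the Weyl density $\frac{1}{N!(2\pi)^N}\prod_{1\le j<\ell\le N}|e^{i\theta_j}-e^{i\theta_\ell}|^2\,d\theta_1\cdots d\theta_N$. The complete homogeneous symmetric polynomial is $h_m(x_1,\dots,x_k)=\sum_{n_1,\dots,n_k\ge 0,\ n_1+\cdots+n_k=m}x_1^{n_1}\cdots x_k^{n_k}$. *)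

theory Defs
  imports "HOL-Analysis.Analysis"
begin

text \<open>
  Joint law of the eigenphases of a Haar-distributed unitary matrix of size \<open>N\<close>, given by Weyl's
  density on \<open>[-\<pi>, \<pi>)\<^sup>N\<close>. The coordinates are indexed by \<open>1, \<dots>, N\<close> and are not ordered by size.
\<close>

definition weyl_density :: "nat \<Rightarrow> (nat \<Rightarrow> real) \<Rightarrow> real" where
  "weyl_density N \<theta> =
     (1 / (fact N * (2 * pi) ^ N)) *
     (\<Prod>l\<in>{1..N}. \<Prod>j\<in>{1..<l}. (cmod (exp (\<i> * of_real (\<theta> j)) - exp (\<i> * of_real (\<theta> l)))) ^ 2)"

definition eigenphase_measure :: "nat \<Rightarrow> (nat \<Rightarrow> real) measure" where
  "eigenphase_measure N =
     density (PiM {1..N} (\<lambda>_. restrict_space lborel {-pi..<pi})) (\<lambda>\<theta>. ennreal (weyl_density N \<theta>))"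

definition haar_expectation :: "nat \<Rightarrow> ((nat \<Rightarrow> real) \<Rightarrow> complex) \<Rightarrow> complex" where
  "haar_expectation N f = (LINT \<theta>|eigenphase_measure N. f \<theta>)"

definition char_poly_Z :: "nat \<Rightarrow> (nat \<Rightarrow> real) \<Rightarrow> complex \<Rightarrow> complex" where
  "char_poly_Z N \<theta> z = (\<Prod>m\<in>{1..N}. 1 - exp (\<i> * of_real (\<theta> m)) * exp (- \<i> * z))"

text \<open>
  The extensional function space makes the exponents range over \<open>k\<close>-tuples exactly once, so that
  the index set is finite.
\<close>

definition complete_homogeneous :: "nat \<Rightarrow> nat \<Rightarrow> (nat \<Rightarrow> complex) \<Rightarrow> complex" where
  "complete_homogeneous m k x =
     (\<Sum>n | n \<in> {1..k} \<rightarrow>\<^sub>E (UNIV :: nat set) \<and> (\<Sum>r=1..k. n r) = m. \<Prod>r=1..k. x r ^ n r)"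

end

theory Submission
  imports Defs "Jordan_Normal_Form.Determinant" "HOL-Computational_Algebra.Polynomial_FPS"
begin

text \<open>
  Put \<open>x\<^sub>r = exp (- \<i> a\<^sub>r / N)\<close> and \<open>n = N - 1\<close>. For fixed \<open>\<theta>\<^sub>N\<close> and \<open>w\<^sub>j = exp (\<i> (\<theta>\<^sub>j - \<theta>\<^sub>N))\<close>, the
  factors of the Weyl density and of the characteristic polynomials that involve \<open>\<theta>\<^sub>N\<close> multiply to
  \<open>\<Prod>\<^sub>r (1 - x\<^sub>r) \<cdot> \<Prod>\<^sub>j (1 - 1/w\<^sub>j) q(w\<^sub>j)\<close> with \<open>q(w) = (1 - w) \<Prod>\<^sub>r (1 - x\<^sub>r w)\<close>. By Andreief's identity
  the integral over the other \<open>n\<close> phases is a Toeplitz determinant, equal to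
  \<open>h\<^sub>0(1, x) + \<dots> + h\<^sub>n(1, x) = h\<^sub>n(1, 1, x)\<close>. Expanding around \<open>x = (1, \<dots>, 1)\<close> with \<open>Y\<^sub>r = N (x\<^sub>r - 1)\<close> gives the exact formula
  \<open>\<Prod>\<^sub>r (- Y\<^sub>r) \<cdot> \<Sum>\<^sub>m (N + k choose m + k + 1) / N ^ (m + k + 1) \<cdot> h\<^sub>m(Y)\<close>. Here \<open>Y\<^sub>r \<rightarrow> - \<i> a\<^sub>r\<close> uniformly,
  and the series converges termwise and dominatedly.
\<close>

section \<open>Two determinants\<close>

lemma det_vandermonde:
  fixes z :: "nat \<Rightarrow> 'a::idom"
  shows "det (mat n n (\<lambda>(i, j). z i ^ j)) = (\<Prod>i<n. \<Prod>l<i. z i - z l)"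
proof -
  \<comment> \<open>Passing to the Newton basis of the nodes makes the matrix triangular.\<close>
  define P where "P j = (\<Prod>l<j. [:- z l, 1:])" for j
  have deg: "degree (P j) = j" for j
    unfolding P_def by (subst degree_prod_eq_sum_degree) auto
  have lc: "coeff (P j) j = 1" for j
    using lead_coeff_prod[of "\<lambda>l. [:- z l, 1:]" "{..<j}"] deg[of j] by (simp add: P_def)
  let ?V = "mat n n (\<lambda>(i, j). z i ^ j)"
  let ?C = "mat n n (\<lambda>(l, j). coeff (P j) l)"
  have "det ?C = 1"
    by (subst det_upper_triangular[of _ n])
      (auto simp: upper_triangular_def prod_list_diag_prod lc deg intro!: coeff_eq_0)
  moreover have "?V * ?C = mat n n (\<lambda>(i, j). poly (P j) (z i))"
  proof (rule eq_matI)
    fix i j assume ij: "i < dim_row (mat n n (\<lambda>(i, j). poly (P j) (z i)))" "j < dim_col (mat n n (\<lambda>(i, j). poly (P j) (z i)))"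
    have "poly (P j) (z i) = (\<Sum>l\<le>j. coeff (P j) l * z i ^ l)"
      by (simp add: poly_altdef deg)
    also have "\<dots> = (\<Sum>l<n. coeff (P j) l * z i ^ l)"
      using ij by (intro sum.mono_neutral_left) (auto simp: deg intro!: coeff_eq_0)
    finally show "(?V * ?C) $$ (i, j) = mat n n (\<lambda>(i, j). poly (P j) (z i)) $$ (i, j)"
      using ij by (simp add: scalar_prod_def mult.commute lessThan_atLeast0)
  qed auto
  \<comment> \<open>\<open>P j\<close> has the root \<open>z i\<close> whenever
    \<open>i < j\<close>, so the matrix of values is lower triangular with diagonal entries
    \<open>poly (P i) (z i)\<close>.\<close>
  moreover have "det (mat n n (\<lambda>(i, j). poly (P j) (z i))) = (\<Prod>i<n. \<Prod>l<i. z i - z l)"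
    by (subst det_lower_triangular[of n])
      (auto simp: prod_list_diag_prod P_def poly_prod lessThan_atLeast0)
  ultimately show ?thesis
    using det_mult[of ?V n ?C] by simp
qed

text \<open>
  Toeplitz determinant of the symbol \<open>(1 - 1/w) q(w)\<close>: multiplying by the Toeplitz matrix of \<open>1/q\<close>
  leaves a bidiagonal matrix up to its first column, and summing rows makes that lower triangular.
\<close>

lemma det_toeplitz_fps:
  fixes q h :: "'a::comm_ring_1 fps"
  assumes qh: "h * q = 1" and q0: "fps_nth q 0 = 1"
  shows "det (mat n n (\<lambda>(i, j). (if j \<le> i then fps_nth q (i - j) else 0)
           - (if j \<le> i + 1 then fps_nth q (i + 1 - j) else 0))) = (\<Sum>j\<le>n. fps_nth h j)"
    (is "det ?M = _")
proof -
  have h0: "fps_nth h 0 = 1"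
    using arg_cong[OF qh, of "\<lambda>f. fps_nth f 0"] q0 by simp
  \<comment> \<open>Coefficients of \<open>h * q = 1\<close>: the lower triangular Toeplitz matrices
    of \<open>h\<close> and \<open>q\<close> are inverse to each other.\<close>
  have conv: "(\<Sum>l\<le>i. fps_nth h (i - l) * (if j \<le> l then fps_nth q (l - j) else 0)) = (if i = j then 1 else 0)" for i j
  proof (cases "j \<le> i")
    case True
    have "(\<Sum>l\<le>i. fps_nth h (i - l) * (if j \<le> l then fps_nth q (l - j) else 0))
        = (\<Sum>l\<in>{j..i}. fps_nth h (i - l) * fps_nth q (l - j))"
      by (intro sum.mono_neutral_cong_right) auto
    also have "\<dots> = (\<Sum>l\<in>{0..i-j}. fps_nth h l * fps_nth q (i - j - l))"
      using True by (intro sum.reindex_bij_witness[of _ "\<lambda>l. i - l" "\<lambda>l. i - l"]) auto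
    also have "\<dots> = fps_nth (h * q) (i - j)"
      by (simp add: fps_mult_nth)
    finally show ?thesis using True by (auto simp: qh)
  qed (auto intro!: sum.neutral)
  \<comment> \<open>With \<open>q\<close> moved up one row, the columns \<open>j > 0\<close> only
    shift the identity, but column 0 lacks the term \<open>h (i + 1) * q 0\<close> of the vanishing
    coefficient \<open>i + 1\<close> of \<open>h * q\<close>.\<close>
  have conv': "(\<Sum>l\<le>i. fps_nth h (i - l) * (if j \<le> l + 1 then fps_nth q (l + 1 - j) else 0)) =
     (if j = 0 then - fps_nth h (i + 1) else if i + 1 = j then 1 else 0)" for i j
  proof (cases j)
    case 0
    have "(\<Sum>l\<le>Suc i. fps_nth h (Suc i - l) * fps_nth q l) = 0"
      using conv[of "Suc i" 0] by simp
    hence "fps_nth h (Suc i) + (\<Sum>l\<le>i. fps_nth h (i - l) * fps_nth q (Suc l)) = 0"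
      by (subst (asm) sum.atMost_Suc_shift) (simp add: q0)
    with 0 show ?thesis by (simp add: eq_neg_iff_add_eq_0 add.commute)
  next
    case (Suc j')
    have "(if j \<le> l + 1 then fps_nth q (l + 1 - j) else 0) = (if j' \<le> l then fps_nth q (l - j') else 0)" for l
      using Suc by simp
    hence "(\<Sum>l\<le>i. fps_nth h (i - l) * (if j \<le> l + 1 then fps_nth q (l + 1 - j) else 0)) = (if i = j' then 1 else 0)"
      by (simp only: conv)
    with Suc show ?thesis by simp
  qed
  \<comment> \<open>\<open>A\<close> turns out to be \<open>?H * ?M\<close>: ones on the diagonal,
    minus ones just above it, and \<open>fps_nth h (i + 1)\<close> added throughout column
    0.\<close>
  define A where "A = mat n n (\<lambda>(i, j). (if i = j then 1 else 0) -
     (if j = 0 then - fps_nth h (i + 1) else if i + 1 = j then 1 else 0))"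
  let ?H = "mat n n (\<lambda>(i, l). if l \<le> i then fps_nth h (i - l) else 0)"
  \<comment> \<open>Multiplying by \<open>?U\<close> replaces row \<open>i\<close> by the sum of the
    rows from \<open>i\<close> on; in every column but the first this telescopes to the
    identity.\<close>
  let ?U = "mat n n (\<lambda>(i, l). if i \<le> l then 1 else 0 :: 'a)"
  have HM: "?H * ?M = A"
  proof (rule eq_matI)
    fix i j assume "i < dim_row A" "j < dim_col A"
    hence ij: "i < n" "j < n" by (auto simp: A_def)
    have "(?H * ?M) $$ (i, j) = (\<Sum>l\<in>{0..<n}. (if l \<le> i then fps_nth h (i - l) else 0) *
       ((if j \<le> l then fps_nth q (l - j) else 0) - (if j \<le> l + 1 then fps_nth q (l + 1 - j) else 0)))"
      using ij by (simp add: scalar_prod_def)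
    also have "\<dots> = (\<Sum>l\<le>i. fps_nth h (i - l) *
       ((if j \<le> l then fps_nth q (l - j) else 0) - (if j \<le> l + 1 then fps_nth q (l + 1 - j) else 0)))"
      using ij by (intro sum.mono_neutral_cong_right) auto
    also have "\<dots> = A $$ (i, j)"
      unfolding right_diff_distrib sum_subtractf conv conv' using ij by (simp add: A_def)
    finally show "(?H * ?M) $$ (i, j) = A $$ (i, j)" .
  qed (auto simp: A_def)
  have UAc: "?U * A \<in> carrier_mat n n" "dim_row (?U * A) = n"
    by (auto simp: A_def)
  have UA: "(?U * A) $$ (i, j) = (\<Sum>s\<in>{i..<n}. A $$ (s, j))" if "i < n" "j < n" for i j
  proof -
    have "(?U * A) $$ (i, j) = (\<Sum>s\<in>{0..<n}. (if i \<le> s then 1 else 0) * A $$ (s, j))"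
      using that by (simp add: scalar_prod_def A_def)
    also have "\<dots> = (\<Sum>s\<in>{i..<n}. A $$ (s, j))"
      by (intro sum.mono_neutral_cong_right) auto
    finally show ?thesis .
  qed
  have UA_pos: "(?U * A) $$ (i, j) = (if i = j then 1 else 0)" if "i < n" "j < n" "j > 0" for i j
  proof -
    have "(?U * A) $$ (i, j) = (\<Sum>s\<in>{i..<n}. (if s = j then 1 else 0) - (if s = j - 1 then 1 else 0))"
      unfolding UA[OF that(1,2)] using that by (intro sum.cong) (auto simp: A_def)
    also have "\<dots> = (if i = j then 1 else 0)"
      unfolding sum_subtractf using that by (auto simp: sum.delta)
    finally show ?thesis .
  qed
  \<comment> \<open>The corner is the only diagonal entry in column 0; the unit in that column
    supplies the missing \<open>fps_nth h 0\<close>.\<close>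
  have UA_0: "(?U * A) $$ (0, 0) = (\<Sum>j\<le>n. fps_nth h j)" if "n > 0"
  proof -
    have "(?U * A) $$ (0, 0) = (\<Sum>s\<in>{0..<n}. (if s = 0 then 1 else 0) + fps_nth h (Suc s))"
      unfolding UA[OF that that] using that by (intro sum.cong) (auto simp: A_def)
    also have "\<dots> = 1 + (\<Sum>s<n. fps_nth h (Suc s))"
      using that by (simp add: sum.distrib lessThan_atLeast0)
    also have "\<dots> = (\<Sum>j\<le>n. fps_nth h j)"
      by (subst lessThan_Suc_atMost[symmetric], subst sum.lessThan_Suc_shift) (simp add: h0)
    finally show ?thesis .
  qed
  have "det (?U * A) = (\<Prod>i = 0..<n. (?U * A) $$ (i, i))"
    using UAc UA_pos by (subst det_lower_triangular[of n]) (simp_all add: prod_list_diag_prod del: index_mult_mat(1))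
  also have "\<dots> = (\<Sum>j\<le>n. fps_nth h j)"
  proof (cases n)
    case 0 thus ?thesis by (simp add: h0)
  next
    case (Suc m)
    have "(\<Prod>i = 0..<n. (?U * A) $$ (i, i)) = (?U * A) $$ (0, 0) * (\<Prod>i = Suc 0..<n. (?U * A) $$ (i, i))"
      by (rule prod.atLeast_Suc_lessThan) (simp add: Suc)
    also have "(\<Prod>i = Suc 0..<n. (?U * A) $$ (i, i)) = 1"
      by (rule prod.neutral) (use UA_pos in \<open>auto simp del: index_mult_mat\<close>)
    finally show ?thesis using UA_0 Suc by simp
  qed
  also have "?U * A = ?U * (?H * ?M)" by (simp only: HM)
  also have "det (?U * (?H * ?M)) = det ?U * (det ?H * det ?M)"
    using det_mult[of ?U n "?H * ?M"] det_mult[of ?H n ?M] by (simp add: mult_carrier_mat[of _ n n])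
  also have "det ?U = 1"
    by (subst det_upper_triangular[of _ n]) (auto simp: upper_triangular_def prod_list_diag_prod)
  also have "det ?H = 1"
    by (subst det_lower_triangular[of n]) (auto simp: prod_list_diag_prod h0)
  finally show ?thesis by simp
qed

section \<open>Complete homogeneous symmetric polynomials\<close>

lemma complete_homogeneous_0_left [simp]: "complete_homogeneous 0 k x = 1"
proof -
  have "{n. n \<in> {1..k} \<rightarrow>\<^sub>E (UNIV :: nat set) \<and> (\<Sum>r=1..k. n r) = 0} = {\<lambda>r\<in>{1..k}. 0}"
    by (auto simp: fun_eq_iff PiE_def extensional_def)
  thus ?thesis by (simp add: complete_homogeneous_def)
qed

lemma complete_homogeneous_0_right: "m > 0 \<Longrightarrow> complete_homogeneous m 0 x = 0"
  by (simp add: complete_homogeneous_def)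

lemma finite_compositions:
  fixes k :: nat
  shows "finite {n. n \<in> {1..k} \<rightarrow>\<^sub>E (UNIV :: nat set) \<and> (\<Sum>r=1..k. n r) = m}"
proof (rule finite_subset)
  show "{n. n \<in> {1..k} \<rightarrow>\<^sub>E UNIV \<and> (\<Sum>r=1..k. n r) = m} \<subseteq> {1..k} \<rightarrow>\<^sub>E {..m}"
  proof (intro subsetI PiE_I)
    fix n r assume n: "n \<in> {n. n \<in> {1..k} \<rightarrow>\<^sub>E UNIV \<and> (\<Sum>r=1..k. n r) = m}" and r: "r \<in> {1..k}"
    have "n r \<le> (\<Sum>r=1..k. n r)" by (rule member_le_sum[OF r]) auto
    with n show "n r \<in> {..m}" by simp
  qed auto
qed (auto intro: finite_PiE)

text \<open>Monomials are sorted by whether \<open>x (Suc k)\<close> occurs; if it does, one factor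
  of it is taken out.\<close>

lemma complete_homogeneous_Suc_Suc:
  "complete_homogeneous (Suc m) (Suc k) x =
     complete_homogeneous (Suc m) k x + x (Suc k) * complete_homogeneous m (Suc k) x"
proof -
  define S :: "nat \<Rightarrow> nat \<Rightarrow> (nat \<Rightarrow> nat) set" where "S m k = {n. n \<in> {1..k} \<rightarrow>\<^sub>E (UNIV :: nat set) \<and> (\<Sum>r=1..k. n r) = m}" for m k
  have fin: "finite (S m k)" for m k unfolding S_def by (rule finite_compositions)
  let ?f = "\<lambda>n. \<Prod>r=1..Suc k. x r ^ n r"
  have split: "S (Suc m) (Suc k) = {n \<in> S (Suc m) (Suc k). n (Suc k) = 0} \<union> {n \<in> S (Suc m) (Suc k). n (Suc k) > 0}"
    by auto
  have "complete_homogeneous (Suc m) (Suc k) x = sum ?f (S (Suc m) (Suc k))"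
    by (simp add: complete_homogeneous_def S_def)
  also have "\<dots> = sum ?f {n \<in> S (Suc m) (Suc k). n (Suc k) = 0} + sum ?f {n \<in> S (Suc m) (Suc k). n (Suc k) > 0}"
    by (subst split, rule sum.union_disjoint) (auto simp: fin)
  also have "sum ?f {n \<in> S (Suc m) (Suc k). n (Suc k) = 0} = (\<Sum>n\<in>S (Suc m) k. \<Prod>r=1..k. x r ^ n r)"
  \<comment> \<open>Tuples over \<open>{1..k}\<close> are extensional, so dropping the last exponent
    means setting it to \<open>undefined\<close>.\<close>
  proof (rule sum.reindex_bij_witness[of _ "\<lambda>n. n(Suc k := 0)" "\<lambda>n. n(Suc k := undefined)"])
    fix n assume n: "n \<in> {n \<in> S (Suc m) (Suc k). n (Suc k) = 0}"
    have *: "(\<Sum>r=1..k. if r = Suc k then undefined else n r) = (\<Sum>r=1..k. n r)" by (rule sum.cong) auto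
    show "n(Suc k := undefined) \<in> S (Suc m) k"
      using n by (auto simp: S_def PiE_def extensional_def *)
  next
    fix n assume n: "n \<in> S (Suc m) k"
    have *: "(\<Sum>r=1..k. if r = Suc k then 0 else n r) = (\<Sum>r=1..k. n r)" by (rule sum.cong) auto
    show "n(Suc k := 0) \<in> {n \<in> S (Suc m) (Suc k). n (Suc k) = 0}"
      using n by (auto simp: S_def PiE_def extensional_def *)
  qed (auto simp: S_def PiE_def extensional_def fun_eq_iff intro!: prod.cong)
  also have "\<dots> = complete_homogeneous (Suc m) k x"
    by (simp add: complete_homogeneous_def S_def)
  also have "sum ?f {n \<in> S (Suc m) (Suc k). n (Suc k) > 0} = (\<Sum>n\<in>S m (Suc k). x (Suc k) * ?f n)"
  proof (rule sum.reindex_bij_witness[of _ "\<lambda>n. n(Suc k := Suc (n (Suc k)))" "\<lambda>n. n(Suc k := n (Suc k) - 1)"])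
    fix n assume n: "n \<in> {n \<in> S (Suc m) (Suc k). n (Suc k) > 0}"
    have *: "(\<Sum>r=1..k. if r = Suc k then c else n r) = (\<Sum>r=1..k. n r)" for c by (rule sum.cong) auto
    show "n(Suc k := n (Suc k) - 1) \<in> S m (Suc k)"
      using n by (auto simp: S_def PiE_def extensional_def *)
  next
    fix n assume n: "n \<in> S m (Suc k)"
    have *: "(\<Sum>r=1..k. if r = Suc k then c else n r) = (\<Sum>r=1..k. n r)" for c by (rule sum.cong) auto
    show "n(Suc k := Suc (n (Suc k))) \<in> {n \<in> S (Suc m) (Suc k). n (Suc k) > 0}"
      using n by (auto simp: S_def PiE_def extensional_def *)
  next
    fix n assume n: "n \<in> {n \<in> S (Suc m) (Suc k). n (Suc k) > 0}"
    have *: "(\<Prod>r=1..k. x r ^ (if r = Suc k then c else n r)) = (\<Prod>r=1..k. x r ^ n r)" for c by (rule prod.cong) auto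
    show "x (Suc k) * ?f (n(Suc k := n (Suc k) - 1)) = ?f n"
      using n by (cases "n (Suc k)") (auto simp: *)
  qed auto
  also have "\<dots> = x (Suc k) * complete_homogeneous m (Suc k) x"
    by (simp add: complete_homogeneous_def S_def sum_distrib_left)
  finally show ?thesis .
qed

text \<open>Both terms of the recurrence are bounded by half of the bound claimed, which is why the
  power of two grows with \<open>m + k\<close>. The estimate is crude but geometric in
  \<open>m\<close>, enough against the factorials of the limit series.\<close>

lemma norm_complete_homogeneous_le:
  assumes "\<And>r. r \<in> {1..k} \<Longrightarrow> cmod (x r) \<le> R" and "R \<ge> 0"
  shows "cmod (complete_homogeneous m k x) \<le> 2 ^ (m + k) * R ^ m"
  using assms(1)
proof (induction k arbitrary: m)
  case 0
  then show ?case
    using assms(2) by (cases m) (auto simp: complete_homogeneous_0_right)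
next
  case (Suc k)
  note IHk = Suc.IH and bound = Suc.prems
  show ?case
  proof (induction m)
    case 0
    show ?case by (simp del: power_Suc)
  next
    case (Suc m)
    have "cmod (complete_homogeneous (Suc m) (Suc k) x) \<le>
       cmod (complete_homogeneous (Suc m) k x) + cmod (x (Suc k)) * cmod (complete_homogeneous m (Suc k) x)"
      unfolding complete_homogeneous_Suc_Suc norm_mult[symmetric] by (rule norm_triangle_ineq)
    also have "\<dots> \<le> 2 ^ (Suc m + k) * R ^ Suc m + R * (2 ^ (m + Suc k) * R ^ m)"
      using IHk[of "Suc m"] bound assms(2) Suc.IH by (intro add_mono mult_mono) auto
    also have "\<dots> = 2 ^ (Suc m + Suc k) * R ^ Suc m" by (simp add: algebra_simps)
    finally show ?case .
  qed
qed

text \<open>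
  The inverse of the second factor generates \<open>h\<^sub>n(1, 1, x\<^sub>1, \<dots>, x\<^sub>k)\<close>; the first is its expansion
  around \<open>x = (1, \<dots>, 1)\<close>.
\<close>

lemma shifted_generating_function:
  "Abs_fps (\<lambda>n. \<Sum>m\<le>n. of_nat ((n + k + 1) choose (m + k + 1)) * complete_homogeneous m k (\<lambda>r. x r - 1))
     * ((1 - fps_X)\<^sup>2 * (\<Prod>r=1..k. 1 - fps_const (x r) * fps_X)) = 1"
proof (induction k)
  case 0
  \<comment> \<open>Without variables only \<open>m = 0\<close> survives, leaving the coefficients
    \<open>n + 1\<close> of the inverse of \<open>(1 - fps_X)\<^sup>2\<close>.\<close>
  have "Abs_fps (\<lambda>n. \<Sum>m\<le>n. of_nat ((n + 0 + 1) choose (m + 0 + 1)) * complete_homogeneous m 0 (\<lambda>r. x r - 1))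
     = Abs_fps (\<lambda>n. of_nat (n + 1))" (is "?L = ?R")
  proof (rule fps_ext)
    fix n
    have "fps_nth ?L n = (\<Sum>m\<in>{0}. of_nat ((n + 0 + 1) choose (m + 0 + 1)) * complete_homogeneous m 0 (\<lambda>r. x r - 1))"
      unfolding fps_nth_Abs_fps by (rule sum.mono_neutral_right) (auto simp: complete_homogeneous_0_right)
    thus "fps_nth ?L n = fps_nth ?R n" by simp
  qed
  moreover have "?R * (1 - fps_X) = Abs_fps (\<lambda>n. 1)"
    by (rule fps_ext) (auto simp: right_diff_distrib fps_X_mult_right_nth of_nat_diff)
  moreover have "Abs_fps (\<lambda>n. 1) * (1 - fps_X) = (1 :: complex fps)"
    by (rule fps_ext) (auto simp: right_diff_distrib fps_X_mult_right_nth)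
  ultimately show ?case by (simp add: power2_eq_square mult.assoc[symmetric])
next
  case (Suc k)
  define y where "y = (\<lambda>r. x r - 1)"
  define S where "S k = Abs_fps (\<lambda>n. \<Sum>m\<le>n. of_nat ((n + k + 1) choose (m + k + 1)) * complete_homogeneous m k y)" for k
  \<comment> \<open>Adjoining a variable divides the generating function by one linear factor; this
    is Pascal's rule combined with the recurrence of the polynomials.\<close>
  have rec: "S (Suc k) * (1 - fps_const (x (Suc k)) * fps_X) = S k"
  proof (rule fps_ext)
    fix n
    show "fps_nth (S (Suc k) * (1 - fps_const (x (Suc k)) * fps_X)) n = fps_nth (S k) n"
    proof (cases n)
      case 0
      then show ?thesis by (simp add: S_def binomial_eq_0)
    next
      case (Suc n')
      define c where "c p m = (of_nat ((n' + k + 2 + p) choose m) :: complex)" for p m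
      define h where "h m = complete_homogeneous m k y" for m
      define g where "g m = complete_homogeneous m (Suc k) y" for m
      have gh: "g (Suc m) = h (Suc m) + y (Suc k) * g m" for m
        by (simp add: g_def h_def complete_homogeneous_Suc_Suc)
      have g0: "g 0 = h 0" by (simp add: g_def h_def)
      have pas: "c 1 (m + k + 2) = c 0 (m + k + 2) + c 0 (m + k + 1)" for m
        by (simp add: c_def binomial_eq_0)
      have "fps_nth (S (Suc k) * (1 - fps_const (x (Suc k)) * fps_X)) n =
         fps_nth (S (Suc k)) (Suc n') - x (Suc k) * fps_nth (S (Suc k)) n'"
      proof -
        have "S (Suc k) * (1 - fps_const (x (Suc k)) * fps_X) = S (Suc k) - fps_const (x (Suc k)) * (S (Suc k) * fps_X)"
          by (simp only: algebra_simps mult_1_left)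
        thus ?thesis by (simp add: Suc fps_X_mult_right_nth)
      qed
      also have "fps_nth (S (Suc k)) (Suc n') = (\<Sum>m\<le>Suc n'. c 1 (m + k + 2) * g m)"
        by (simp add: S_def c_def g_def eval_nat_numeral del: binomial_Suc_Suc sum.atMost_Suc)
      also have "fps_nth (S (Suc k)) n' = (\<Sum>m\<le>n'. c 0 (m + k + 2) * g m)"
        by (simp add: S_def c_def g_def)
      \<comment> \<open>The added term at \<open>m = Suc n'\<close> has binomial coefficient 0; now
        both sums share one range.\<close>
      also have "\<dots> = (\<Sum>m\<le>Suc n'. c 0 (m + k + 2) * g m)"
        by (simp add: c_def binomial_eq_0)
      \<comment> \<open>Writing \<open>x (Suc k) = 1 + y (Suc k)\<close>, the unit part cancels one
        of the two sums produced by \<open>pas\<close>.\<close>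
      also have "(\<Sum>m\<le>Suc n'. c 1 (m + k + 2) * g m) - x (Suc k) * (\<Sum>m\<le>Suc n'. c 0 (m + k + 2) * g m)
          = (\<Sum>m\<le>Suc n'. c 0 (m + k + 1) * g m) - y (Suc k) * (\<Sum>m\<le>Suc n'. c 0 (m + k + 2) * g m)"
        unfolding pas distrib_right sum.distrib by (simp add: y_def algebra_simps)
      \<comment> \<open>The recurrence \<open>gh\<close> splits off a multiple of
        \<open>y (Suc k)\<close> that cancels the subtracted sum.\<close>
      also have "(\<Sum>m\<le>Suc n'. c 0 (m + k + 1) * g m) =
          c 0 (k + 1) * h 0 + (\<Sum>m\<le>n'. c 0 (m + k + 2) * h (Suc m)) + y (Suc k) * (\<Sum>m\<le>n'. c 0 (m + k + 2) * g m)"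
        by (subst sum.atMost_Suc_shift) (simp add: gh g0 algebra_simps sum.distrib sum_distrib_left)
      also have "c 0 (k + 1) * h 0 + (\<Sum>m\<le>n'. c 0 (m + k + 2) * h (Suc m)) = (\<Sum>m\<le>Suc n'. c 0 (m + k + 1) * h m)"
        by (subst sum.atMost_Suc_shift) simp
      also have "(\<Sum>m\<le>n'. c 0 (m + k + 2) * g m) = (\<Sum>m\<le>Suc n'. c 0 (m + k + 2) * g m)"
        by (simp add: c_def binomial_eq_0)
      finally show ?thesis
        by (simp add: S_def c_def h_def Suc del: sum.atMost_Suc)
    qed
  qed
  have "S (Suc k) * ((1 - fps_X)\<^sup>2 * (\<Prod>r=1..Suc k. 1 - fps_const (x r) * fps_X)) =
    (S (Suc k) * (1 - fps_const (x (Suc k)) * fps_X)) * ((1 - fps_X)\<^sup>2 * (\<Prod>r=1..k. 1 - fps_const (x r) * fps_X))"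
    by (simp add: mult_ac)
  also have "\<dots> = 1" unfolding rec using Suc.IH by (simp add: S_def y_def)
  finally show ?case by (simp add: S_def y_def)
qed

lemma complete_homogeneous_scale:
  "complete_homogeneous m k (\<lambda>r. c * x r) = c ^ m * complete_homogeneous m k x"
  unfolding complete_homogeneous_def sum_distrib_left
  by (rule sum.cong) (auto simp: power_mult_distrib prod.distrib power_sum)

section \<open>Integrals over the torus\<close>

abbreviation arc_measure :: "real measure" where
  "arc_measure \<equiv> restrict_space lborel {-pi..<pi}"

lemma integrable_arc_measure:
  fixes f :: "real \<Rightarrow> complex"
  assumes "continuous_on UNIV f"
  shows "integrable arc_measure f"
proof -
  have "set_integrable lborel {-pi..pi} f"
    by (rule borel_integrable_atLeastAtMost') (rule continuous_on_subset[OF assms], simp)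
  hence "set_integrable lborel {-pi..<pi} f"
    by (rule set_integrable_subset) auto
  thus ?thesis by (simp add: integrable_restrict_space set_integrable_def)
qed

interpretation arc: finite_measure arc_measure
  by (rule finite_measureI) (simp add: emeasure_restrict_space space_restrict_space)

interpretation arcs: product_sigma_finite "\<lambda>_::nat. arc_measure"
  by unfold_locales

text \<open>Orthogonality of the characters. The base point \<open>\<phi>\<close> is arbitrary
  because phases will be measured from the last one; the arc is a full period, so the shift does no
  harm.\<close>

lemma integral_arc_exp:
  fixes m :: int
  shows "(LINT \<theta>|arc_measure. exp (\<i> * of_int m * of_real (\<theta> - \<phi>))) = (if m = 0 then 2 * of_real pi else 0)"
proof -
  let ?f = "\<lambda>\<theta>. exp (\<i> * of_int m * of_real (\<theta> - \<phi>))"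
  have "(LINT \<theta>|arc_measure. ?f \<theta>) = (LBINT \<theta>:{-pi..<pi}. ?f \<theta>)"
    by (simp add: integral_restrict_space set_lebesgue_integral_def)
  also have "\<dots> = (LBINT \<theta>=-pi..pi. ?f \<theta>)"
    by (subst interval_integral_Ico) auto
  also have "\<dots> = (if m = 0 then 2 * of_real pi else 0)"
  proof (cases "m = 0")
    case True
    have "(complex_of_real has_vector_derivative 1) (at x within S)" for x S
      unfolding has_vector_derivative_def by (auto intro!: derivative_eq_intros simp: scaleR_conv_of_real)
    with True show ?thesis
      using interval_integral_FTC_finite[of "-pi" pi "\<lambda>_. 1 :: complex" complex_of_real] by simp
  next
    case False
    let ?F = "\<lambda>\<theta>. exp (\<i> * of_int m * of_real (\<theta> - \<phi>)) / (\<i> * of_int m)"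
    \<comment> \<open>The endpoints differ by \<open>2 * pi\<close>, so the antiderivative takes the
      same value at both.\<close>
    have "exp (\<i> * of_int m * of_real (pi - \<phi>)) =
       exp ((2 * of_int m * complex_of_real pi) * \<i>) * exp (\<i> * of_int m * of_real (-pi - \<phi>))"
      unfolding exp_add[symmetric] by (simp add: algebra_simps)
    also have "exp ((2 * of_int m * complex_of_real pi) * \<i>) = 1"
      using exp_integer_2pi[of "real_of_int m"] by simp
    finally have per: "?F pi = ?F (-pi)" by simp
    have deriv: "((\<lambda>z. exp (\<i> * of_int m * (z - of_real \<phi>)) / (\<i> * of_int m)) has_field_derivative
        exp (\<i> * of_int m * (of_real x - of_real \<phi>))) (at (of_real x))" for x
      using False by (auto intro!: derivative_eq_intros)
    have "(LBINT \<theta>=-pi..pi. ?f \<theta>) = ?F pi - ?F (-pi)"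
    proof (rule interval_integral_FTC_finite)
      show "continuous_on {min (-pi) pi..max (-pi) pi} ?f"
        by (intro continuous_intros)
      fix x
      show "(?F has_vector_derivative ?f x) (at x within {min (-pi) pi..max (-pi) pi})"
        using has_vector_derivative_real_field[OF deriv] by simp
    qed
    with per False show ?thesis by simp
  qed
  finally show ?thesis .
qed

lemma integral_arc_powers:
  "(LINT \<theta>|arc_measure. exp (\<i> * of_real (\<theta> - \<phi>)) ^ a * inverse (exp (\<i> * of_real (\<theta> - \<phi>))) ^ b)
     = (if a = b then 2 * of_real pi else 0)"
proof -
  have "exp (\<i> * of_real (\<theta> - \<phi>)) ^ a * inverse (exp (\<i> * of_real (\<theta> - \<phi>))) ^ b
      = exp (\<i> * of_int (int a - int b) * of_real (\<theta> - \<phi>))" for \<theta>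
    unfolding exp_minus[symmetric] exp_of_nat_mult[symmetric] exp_add[symmetric]
    by (simp add: algebra_simps)
  thus ?thesis by (simp only: integral_arc_exp) simp
qed

text \<open>Orthogonality extracts one coefficient of \<open>q\<close>. The guard
  \<open>j \<le> i\<close> compensates for truncated subtraction in \<open>i - j\<close>.\<close>

lemma integral_arc_poly:
  fixes q :: "complex poly"
  shows "(LINT \<theta>|arc_measure. poly q (exp (\<i> * of_real (\<theta> - \<phi>))) * inverse (exp (\<i> * of_real (\<theta> - \<phi>))) ^ i
            * exp (\<i> * of_real (\<theta> - \<phi>)) ^ j)
     = 2 * of_real pi * (if j \<le> i then coeff q (i - j) else 0)"
proof -
  let ?w = "\<lambda>\<theta>. exp (\<i> * of_real (\<theta> - \<phi>))"
  have "(LINT \<theta>|arc_measure. poly q (?w \<theta>) * inverse (?w \<theta>) ^ i * ?w \<theta> ^ j) =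
      (LINT \<theta>|arc_measure. (\<Sum>s\<le>degree q. coeff q s * (?w \<theta> ^ (s + j) * inverse (?w \<theta>) ^ i)))"
    unfolding poly_altdef sum_distrib_right power_add
    by (intro Bochner_Integration.integral_cong sum.cong refl) (simp only: mult_ac)
  also have "\<dots> = (\<Sum>s\<le>degree q. coeff q s * (LINT \<theta>|arc_measure. ?w \<theta> ^ (s + j) * inverse (?w \<theta>) ^ i))"
    by (subst Bochner_Integration.integral_sum)
      (auto intro!: integrable_arc_measure continuous_intros integrable_mult_right)
  also have "\<dots> = (\<Sum>s\<le>degree q. if s = i - j then (if j \<le> i then 2 * of_real pi * coeff q s else 0) else 0)"
    unfolding integral_arc_powers by (intro sum.cong) auto
  also have "\<dots> = 2 * of_real pi * (if j \<le> i then coeff q (i - j) else 0)"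
    by (auto simp: coeff_eq_0)
  finally show ?thesis .
qed

text \<open>The factor \<open>1 - 1/w\<close> makes each entry a difference of neighbouring
  coefficients, the shape of the matrix in \<open>det_toeplitz_fps\<close>.\<close>

lemma integral_arc_toeplitz_symbol:
  fixes q :: "complex poly"
  shows "(LINT \<theta>|arc_measure. poly q (exp (\<i> * of_real (\<theta> - \<phi>))) * (1 - inverse (exp (\<i> * of_real (\<theta> - \<phi>))))
            * inverse (exp (\<i> * of_real (\<theta> - \<phi>))) ^ i * exp (\<i> * of_real (\<theta> - \<phi>)) ^ j)
     = 2 * of_real pi * ((if j \<le> i then coeff q (i - j) else 0) - (if j \<le> i + 1 then coeff q (i + 1 - j) else 0))"
proof -
  let ?w = "\<lambda>\<theta>. exp (\<i> * of_real (\<theta> - \<phi>))"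
  have "(LINT \<theta>|arc_measure. poly q (?w \<theta>) * (1 - inverse (?w \<theta>)) * inverse (?w \<theta>) ^ i * ?w \<theta> ^ j) =
    (LINT \<theta>|arc_measure. poly q (?w \<theta>) * inverse (?w \<theta>) ^ i * ?w \<theta> ^ j
        - poly q (?w \<theta>) * inverse (?w \<theta>) ^ (i + 1) * ?w \<theta> ^ j)"
    by (simp add: algebra_simps)
  also have "\<dots> = (LINT \<theta>|arc_measure. poly q (?w \<theta>) * inverse (?w \<theta>) ^ i * ?w \<theta> ^ j)
        - (LINT \<theta>|arc_measure. poly q (?w \<theta>) * inverse (?w \<theta>) ^ (i + 1) * ?w \<theta> ^ j)"
    by (intro Bochner_Integration.integral_diff integrable_arc_measure continuous_intros continuous_on_poly) auto
  finally show ?thesis unfolding integral_arc_poly by (simp add: right_diff_distrib)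
qed

section \<open>Determinants integrated over several phases\<close>

text \<open>Both determinants are expanded over permutations and each term is integrated one
  coordinate at a time. Every permutation \<open>p\<close> of the first then contributes the same
  determinant, which explains \<open>fact n\<close>. Coordinates are \<open>Suc l\<close> because
  phases are numbered from 1 and matrix rows from 0.\<close>

lemma andreief_identity:
  fixes v :: "'a \<Rightarrow> complex" and f g :: "nat \<Rightarrow> 'a \<Rightarrow> complex"
  assumes "sigma_finite_measure M"
    and int: "\<And>i j. i < n \<Longrightarrow> j < n \<Longrightarrow> integrable M (\<lambda>x. v x * f i x * g j x)"
  shows "(LINT x|PiM {1..n} (\<lambda>_. M). (\<Prod>l<n. v (x (Suc l))) * det (mat n n (\<lambda>(l, i). f i (x (Suc l))))
            * det (mat n n (\<lambda>(l, i). g i (x (Suc l)))))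
       = fact n * det (mat n n (\<lambda>(i, j). LINT x|M. v x * f i x * g j x))"
proof -
  interpret product_sigma_finite "\<lambda>_::nat. M"
    using assms(1) by (simp add: product_sigma_finite_def)
  let ?P = "{p. p permutes {0..<n}}"
  let ?h = "\<lambda>p q l x. v x * f (p l) x * g (q l) x"
  let ?m = "mat n n (\<lambda>(i, j). LINT x|M. v x * f i x * g j x)"
  have perm: "p l < n" if "p \<in> ?P" "l < n" for p l
    using that permutes_in_image[of p "{0..<n}" l] by auto
  have shift: "(\<Prod>l<n. F l (x (Suc l))) = (\<Prod>r\<in>{1..n}. F (r - 1) (x r))" for F :: "nat \<Rightarrow> 'a \<Rightarrow> complex" and x
    by (simp add: prod.atLeast1_atMost_eq)
  have intg: "integrable M (?h p q (r - 1))" if "p \<in> ?P" "q \<in> ?P" "r \<in> {1..n}" for p q r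
    using that perm[of p "r - 1"] perm[of q "r - 1"] by (intro int) auto
  have intP: "integrable (PiM {1..n} (\<lambda>_. M)) (\<lambda>x. \<Prod>l<n. ?h p q l (x (Suc l)))" if "p \<in> ?P" "q \<in> ?P" for p q
    unfolding shift[of "?h p q"] by (rule product_integrable_prod) (use that intg in auto)
  have eq: "(LINT x|PiM {1..n} (\<lambda>_. M). (\<Prod>l<n. ?h p q l (x (Suc l)))) = (\<Prod>l<n. ?m $$ (p l, q l))"
    if "p \<in> ?P" "q \<in> ?P" for p q
  proof -
    have "(LINT x|PiM {1..n} (\<lambda>_. M). (\<Prod>l<n. ?h p q l (x (Suc l)))) = (\<Prod>r\<in>{1..n}. (LINT x|M. ?h p q (r - 1) x))"
      unfolding shift[of "?h p q"] by (rule product_integral_prod) (use that intg in auto)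
    also have "\<dots> = (\<Prod>l<n. (LINT x|M. ?h p q l x))"
      by (simp add: prod.atLeast1_atMost_eq)
    also have "\<dots> = (\<Prod>l<n. ?m $$ (p l, q l))"
      using that by (intro prod.cong) (auto simp: perm)
    finally show ?thesis .
  qed
  have "(\<Prod>l<n. v (x (Suc l))) * det (mat n n (\<lambda>(l, i). f i (x (Suc l)))) * det (mat n n (\<lambda>(l, i). g i (x (Suc l))))
      = (\<Sum>p\<in>?P. \<Sum>q\<in>?P. signof p * signof q * (\<Prod>l<n. ?h p q l (x (Suc l))))" for x
  proof -
    have d: "det (mat n n (\<lambda>(l, i). F i (x (Suc l)))) = (\<Sum>p\<in>?P. signof p * (\<Prod>l<n. F (p l) (x (Suc l))))"
      for F :: "nat \<Rightarrow> 'a \<Rightarrow> complex"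
      unfolding det_def'[OF mat_carrier] lessThan_atLeast0
      by (intro sum.cong refl arg_cong2[of _ _ _ _ "(*)"] prod.cong) (auto simp: perm)
    show ?thesis
      unfolding d mult.assoc unfolding sum_product unfolding sum_distrib_left prod.distrib
      by (intro sum.cong refl) (simp only: mult_ac)
  qed
  hence "(LINT x|PiM {1..n} (\<lambda>_. M). (\<Prod>l<n. v (x (Suc l))) * det (mat n n (\<lambda>(l, i). f i (x (Suc l))))
            * det (mat n n (\<lambda>(l, i). g i (x (Suc l)))))
     = (LINT x|PiM {1..n} (\<lambda>_. M). (\<Sum>p\<in>?P. \<Sum>q\<in>?P. signof p * signof q * (\<Prod>l<n. ?h p q l (x (Suc l)))))"
    by presburger
  also have "\<dots> = (\<Sum>p\<in>?P. (LINT x|PiM {1..n} (\<lambda>_. M). (\<Sum>q\<in>?P. signof p * signof q * (\<Prod>l<n. ?h p q l (x (Suc l))))))"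
    by (intro Bochner_Integration.integral_sum Bochner_Integration.integrable_sum integrable_mult_right intP)
  also have "\<dots> = (\<Sum>p\<in>?P. \<Sum>q\<in>?P. signof p * signof q * (\<Prod>l<n. ?m $$ (p l, q l)))"
  proof (intro sum.cong refl)
    fix p assume p: "p \<in> ?P"
    have "(LINT x|PiM {1..n} (\<lambda>_. M). (\<Sum>q\<in>?P. signof p * signof q * (\<Prod>l<n. ?h p q l (x (Suc l)))))
        = (\<Sum>q\<in>?P. (LINT x|PiM {1..n} (\<lambda>_. M). signof p * signof q * (\<Prod>l<n. ?h p q l (x (Suc l)))))"
      using p by (intro Bochner_Integration.integral_sum integrable_mult_right intP)
    also have "\<dots> = (\<Sum>q\<in>?P. signof p * signof q * (\<Prod>l<n. ?m $$ (p l, q l)))"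
      using p by (intro sum.cong refl) (simp only: integral_mult_right_zero eq)
    finally show "(LINT x|PiM {1..n} (\<lambda>_. M). (\<Sum>q\<in>?P. signof p * signof q * (\<Prod>l<n. ?h p q l (x (Suc l)))))
        = (\<Sum>q\<in>?P. signof p * signof q * (\<Prod>l<n. ?m $$ (p l, q l)))" .
  qed
  also have "\<dots> = (\<Sum>p\<in>?P. det ?m)"
  proof (intro sum.cong refl)
    fix p assume p: "p \<in> ?P"
    \<comment> \<open>For fixed \<open>p\<close> the sum over \<open>q\<close> is the Leibniz
      expansion of \<open>?m\<close> with rows permuted by \<open>p\<close>; undoing this gives a
      second \<open>signof p\<close>, and the two signs cancel.\<close>
    have "(\<Sum>q\<in>?P. signof p * signof q * (\<Prod>l<n. ?m $$ (p l, q l)))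
        = signof p * det (mat n n (\<lambda>(i, j). ?m $$ (p i, j)))"
      unfolding det_def'[OF mat_carrier] sum_distrib_left mult.assoc lessThan_atLeast0
      using p by (intro sum.cong refl arg_cong2[of _ _ _ _ "(*)"] prod.cong) (auto simp: perm)
    also have "\<dots> = signof p * (signof p * det ?m)"
      using p by (subst det_permute_rows[of _ n]) auto
    also have "\<dots> = det ?m"
      by (simp add: mult.assoc[symmetric] of_int_mult[symmetric] sign_idempotent del: of_int_mult)
    finally show "(\<Sum>q\<in>?P. signof p * signof q * (\<Prod>l<n. ?m $$ (p l, q l))) = det ?m" .
  qed
  also have "\<dots> = fact n * det ?m"
    using card_permutations[of "{0..<n}" n] by simp
  finally show ?thesis .
qed

text \<open>Andreief's identity with the weight \<open>(1 - 1/w) q(w)\<close> and the functions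
  \<open>w^-i\<close> and \<open>w^j\<close>. Each entry carries a factor \<open>2 * pi\<close>, and
  the remaining Toeplitz determinant is a partial sum of the coefficients of
  \<open>1/q\<close>.\<close>

lemma toeplitz_integral:
  fixes q :: "complex poly" and h :: "complex fps"
  assumes "h * fps_of_poly q = 1" and "coeff q 0 = 1"
  defines "w \<equiv> \<lambda>\<phi> \<theta>. exp (\<i> * of_real (\<theta> - \<phi>)) :: complex"
  shows "(LINT x|PiM {1..n} (\<lambda>_. arc_measure). (\<Prod>l<n. poly q (w \<phi> (x (Suc l))) * (1 - inverse (w \<phi> (x (Suc l)))))
       * det (mat n n (\<lambda>(l, i). inverse (w \<phi> (x (Suc l))) ^ i)) * det (mat n n (\<lambda>(l, i). w \<phi> (x (Suc l)) ^ i)))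
     = fact n * (2 * of_real pi) ^ n * (\<Sum>j\<le>n. fps_nth h j)"
proof -
  define T where "T = mat n n (\<lambda>(i, j). (if j \<le> i then fps_nth (fps_of_poly q) (i - j) else 0)
           - (if j \<le> i + 1 then fps_nth (fps_of_poly q) (i + 1 - j) else 0))"
  have "(LINT x|PiM {1..n} (\<lambda>_. arc_measure). (\<Prod>l<n. poly q (w \<phi> (x (Suc l))) * (1 - inverse (w \<phi> (x (Suc l)))))
       * det (mat n n (\<lambda>(l, i). inverse (w \<phi> (x (Suc l))) ^ i)) * det (mat n n (\<lambda>(l, i). w \<phi> (x (Suc l)) ^ i)))
     = fact n * det (mat n n (\<lambda>(i, j). LINT \<theta>|arc_measure. poly q (w \<phi> \<theta>) * (1 - inverse (w \<phi> \<theta>)) * inverse (w \<phi> \<theta>) ^ i * w \<phi> \<theta> ^ j))"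
    by (rule andreief_identity)
      (auto simp: w_def intro!: integrable_arc_measure continuous_intros continuous_on_poly arc.sigma_finite_measure_axioms)
  also have "mat n n (\<lambda>(i, j). LINT \<theta>|arc_measure. poly q (w \<phi> \<theta>) * (1 - inverse (w \<phi> \<theta>)) * inverse (w \<phi> \<theta>) ^ i * w \<phi> \<theta> ^ j)
      = (2 * of_real pi) \<cdot>\<^sub>m T"
    unfolding w_def integral_arc_toeplitz_symbol T_def by (rule eq_matI) auto
  also have "det ((2 * of_real pi) \<cdot>\<^sub>m T) = (2 * of_real pi) ^ n * det T"
    by (simp add: T_def)
  also have "det T = (\<Sum>j\<le>n. fps_nth h j)"
    unfolding T_def by (rule det_toeplitz_fps[OF assms(1)]) (simp add: assms(2))
  finally show ?thesis by (simp add: mult.assoc)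
qed

section \<open>The exact expectation at finite matrix size\<close>

text \<open>Rotation by \<open>\<phi>\<close> preserves distances, and on the unit circle
  conjugation is inversion; the squared distance thus splits into one factor for each of two
  Vandermonde determinants.\<close>

lemma cmod_exp_diff_squared:
  fixes s t \<phi> :: real
  defines "w \<equiv> \<lambda>\<theta>. exp (\<i> * of_real (\<theta> - \<phi>)) :: complex"
  shows "complex_of_real ((cmod (exp (\<i> * of_real s) - exp (\<i> * of_real t)))\<^sup>2) = (inverse (w t) - inverse (w s)) * (w t - w s)"
proof -
  have "exp (\<i> * of_real s) - exp (\<i> * of_real t) = exp (\<i> * of_real \<phi>) * (w s - w t)"
    by (simp add: w_def right_diff_distrib exp_add[symmetric])
  hence "cmod (exp (\<i> * of_real s) - exp (\<i> * of_real t)) = cmod (w s - w t)"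
    by (simp add: norm_mult)
  moreover have "cnj (w \<theta>) = inverse (w \<theta>)" for \<theta>
    by (simp add: w_def exp_cnj exp_minus[symmetric])
  ultimately show ?thesis
    by (simp only: complex_norm_square complex_cnj_diff) (simp add: algebra_simps)
qed

text \<open>The last phase has \<open>w = 1\<close>, so each pair involving it gives
  \<open>(1 - w)(1 - 1/w)\<close>; the other pairs form the two Vandermonde determinants.\<close>

lemma weyl_density_Suc:
  fixes x :: "nat \<Rightarrow> real" and n :: nat
  defines "w \<equiv> \<lambda>\<theta>. exp (\<i> * of_real (\<theta> - x (Suc n))) :: complex"
  shows "complex_of_real (weyl_density (Suc n) x) = 1 / (fact (Suc n) * (2 * of_real pi) ^ Suc n)
     * ((\<Prod>l<n. (1 - w (x (Suc l))) * (1 - inverse (w (x (Suc l)))))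
     * det (mat n n (\<lambda>(l, i). inverse (w (x (Suc l))) ^ i)) * det (mat n n (\<lambda>(l, i). w (x (Suc l)) ^ i)))"
proof -
  let ?D = "\<lambda>s t. complex_of_real ((cmod (exp (\<i> * of_real (x s)) - exp (\<i> * of_real (x t))))\<^sup>2)"
  have w1: "w (x (Suc n)) = 1" by (simp add: w_def)
  have D: "?D s t = (inverse (w (x t)) - inverse (w (x s))) * (w (x t) - w (x s))" for s t
    unfolding w_def by (rule cmod_exp_diff_squared)
  have "(\<Prod>l\<in>{1..Suc n}. \<Prod>j\<in>{1..<l}. ?D j l) = (\<Prod>l<n. \<Prod>j\<in>{1..<Suc l}. ?D j (Suc l)) * (\<Prod>j\<in>{1..<Suc n}. ?D j (Suc n))"
    by (simp add: prod.atLeast1_atMost_eq)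
  also have "(\<Prod>j\<in>{1..<Suc n}. ?D j (Suc n)) = (\<Prod>l<n. (1 - w (x (Suc l))) * (1 - inverse (w (x (Suc l)))))"
    unfolding D w1 by (simp add: atLeastLessThanSuc_atLeastAtMost prod.atLeast1_atMost_eq mult.commute)
  also have "(\<Prod>l<n. \<Prod>j\<in>{1..<Suc l}. ?D j (Suc l)) =
      (\<Prod>l<n. \<Prod>j<l. inverse (w (x (Suc l))) - inverse (w (x (Suc j)))) * (\<Prod>l<n. \<Prod>j<l. w (x (Suc l)) - w (x (Suc j)))"
    unfolding D by (simp add: atLeastLessThanSuc_atLeastAtMost prod.atLeast1_atMost_eq prod.distrib)
  also have "\<dots> = det (mat n n (\<lambda>(l, i). inverse (w (x (Suc l))) ^ i)) * det (mat n n (\<lambda>(l, i). w (x (Suc l)) ^ i))"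
    unfolding det_vandermonde ..
  finally have "(\<Prod>l\<in>{1..Suc n}. \<Prod>j\<in>{1..<l}. ?D j l) = (\<Prod>l<n. (1 - w (x (Suc l))) * (1 - inverse (w (x (Suc l)))))
     * det (mat n n (\<lambda>(l, i). inverse (w (x (Suc l))) ^ i)) * det (mat n n (\<lambda>(l, i). w (x (Suc l)) ^ i))"
    by (simp only: mult_ac)
  moreover have "complex_of_real (weyl_density (Suc n) x) = 1 / (fact (Suc n) * (2 * of_real pi) ^ Suc n) * (\<Prod>l\<in>{1..Suc n}. \<Prod>j\<in>{1..<l}. ?D j l)"
    unfolding weyl_density_def by simp
  ultimately show ?thesis by simp
qed

text \<open>Eigenvalue \<open>Suc n\<close> gives the factor outside the product; the others enter
  only through their phase relative to it.\<close>

lemma char_poly_Z_Suc: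
  "char_poly_Z (Suc n) x (of_real (x (Suc n)) + b) =
     (1 - exp (- \<i> * b)) * (\<Prod>l<n. 1 - exp (- \<i> * b) * exp (\<i> * of_real (x (Suc l) - x (Suc n))))"
proof -
  have "exp (\<i> * of_real (x m)) * exp (- \<i> * (of_real (x (Suc n)) + b)) = exp (- \<i> * b) * exp (\<i> * of_real (x m - x (Suc n)))" for m
    unfolding exp_add[symmetric] by (simp add: algebra_simps)
  thus ?thesis
    unfolding char_poly_Z_def by (simp add: prod.atLeast1_atMost_eq mult.commute)
qed

lemma borel_measurable_arc_component:
  "i \<in> I \<Longrightarrow> (\<lambda>x. x i) \<in> borel_measurable (PiM I (\<lambda>_. arc_measure))"
  by (rule measurable_compose[OF measurable_component_singleton[where M = "\<lambda>_. arc_measure"]])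
    (simp_all add: measurable_restrict_space1)

lemma borel_measurable_exp_arc_component:
  assumes "i \<in> I"
  shows "(\<lambda>x. exp (\<i> * complex_of_real (x i))) \<in> borel_measurable (PiM I (\<lambda>_. arc_measure))"
  using borel_measurable_arc_component[OF assms]
  by (rule measurable_compose) (intro borel_measurable_continuous_onI continuous_intros)

lemma borel_measurable_weyl_density:
  "weyl_density n \<in> borel_measurable (PiM {1..n} (\<lambda>_. arc_measure))"
  unfolding weyl_density_def[abs_def]
  by (intro borel_measurable_times borel_measurable_prod borel_measurable_power
      measurable_compose[OF _ borel_measurable_norm] borel_measurable_diff
      borel_measurable_const borel_measurable_exp_arc_component) auto

text \<open>The integral over the first \<open>n\<close> phases does not depend on the last one,
  whose own integral is \<open>2 * pi\<close>. Andreief's identity supplies \<open>fact n\<close>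
  against \<open>fact (Suc n)\<close> in the density, so \<open>1 / of_nat (Suc n)\<close>
  remains.\<close>

lemma haar_expectation_char_poly_Z:
  fixes b :: "nat \<Rightarrow> complex"
  defines "e \<equiv> \<lambda>r. exp (- \<i> * b r)"
  shows "haar_expectation (Suc n) (\<lambda>\<theta>. \<Prod>r=1..k. char_poly_Z (Suc n) \<theta> (of_real (\<theta> (Suc n)) + b r)) =
    1 / of_nat (Suc n) * (\<Prod>r=1..k. 1 - e r)
      * (\<Sum>m\<le>n. of_nat ((n + k + 1) choose (m + k + 1)) * complete_homogeneous m k (\<lambda>r. e r - 1))"
proof -
  let ?P = "PiM {1..Suc n} (\<lambda>_. arc_measure)"
  let ?F = "\<lambda>\<theta>. \<Prod>r=1..k. char_poly_Z (Suc n) \<theta> (of_real (\<theta> (Suc n)) + b r)"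
  let ?G = "\<lambda>\<theta>. weyl_density (Suc n) \<theta> *\<^sub>R ?F \<theta>"
  \<comment> \<open>The factor \<open>[:1, -1:]\<close> comes from the Weyl density, the others from
    the characteristic polynomials.\<close>
  define q where "q = [:1, -1:] * (\<Prod>r=1..k. [:1, - e r:])"
  define S where "S = Abs_fps (\<lambda>n. \<Sum>m\<le>n. of_nat ((n + k + 1) choose (m + k + 1)) * complete_homogeneous m k (\<lambda>r. e r - 1))"
  define C where "C = 1 / (fact (Suc n) * (2 * of_real pi) ^ Suc n) * (\<Prod>r=1..k. 1 - e r)"
  define w where "w \<phi> \<theta> = exp (\<i> * of_real (\<theta> - \<phi>))" for \<phi> \<theta> :: real
  have F_eq: "?F x = (\<Prod>r=1..k. 1 - e r) * (\<Prod>l<n. \<Prod>r=1..k. 1 - e r * w (x (Suc n)) (x (Suc l)))" for x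
    unfolding char_poly_Z_Suc prod.distrib e_def w_def by (subst prod.swap) simp
  have G: "?G x = C * ((\<Prod>l<n. poly q (w (x (Suc n)) (x (Suc l))) * (1 - inverse (w (x (Suc n)) (x (Suc l)))))
       * det (mat n n (\<lambda>(l, i). inverse (w (x (Suc n)) (x (Suc l))) ^ i)) * det (mat n n (\<lambda>(l, i). w (x (Suc n)) (x (Suc l)) ^ i)))" for x
  proof -
    have "poly q z = (1 - z) * (\<Prod>r=1..k. 1 - e r * z)" for z
      by (simp add: q_def poly_prod mult.commute algebra_simps)
    thus ?thesis
      unfolding F_eq scaleR_conv_of_real weyl_density_Suc C_def w_def[symmetric] by (simp only: prod.distrib mult_ac)
  qed
  \<comment> \<open>\<open>S\<close> inverts the product with \<open>(1 - fps_X)\<^sup>2\<close>,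
    while \<open>q\<close> has only one such factor, so the other one joins
    \<open>S\<close>.\<close>
  have qS: "(1 - fps_X) * S * fps_of_poly q = 1"
  proof -
    have lin: "fps_of_poly [:1, - c:] = 1 - fps_const c * fps_X" for c :: complex
      by (simp add: fps_of_poly_pCons algebra_simps flip: fps_const_neg)
    have "fps_of_poly q = (1 - fps_X) * (\<Prod>r=1..k. 1 - fps_const (e r) * fps_X)"
      unfolding q_def fps_of_poly_mult fps_of_poly_prod lin by simp
    hence "(1 - fps_X) * S * fps_of_poly q = S * ((1 - fps_X)\<^sup>2 * (\<Prod>r=1..k. 1 - fps_const (e r) * fps_X))"
      by (simp add: power2_eq_square mult_ac)
    thus ?thesis unfolding S_def shifted_generating_function .
  qed
  have q0: "coeff q 0 = 1"
    by (simp add: q_def poly_0_coeff_0[symmetric] poly_prod)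
  \<comment> \<open>Multiplication by \<open>1 - fps_X\<close> takes differences of coefficients, so
    the partial sums telescope.\<close>
  have sumS: "(\<Sum>j\<le>n. fps_nth ((1 - fps_X) * S) j) = fps_nth S n"
  proof (induction n)
    case (Suc n)
    have "fps_nth ((1 - fps_X) * S) (Suc n) = fps_nth S (Suc n) - fps_nth S n"
      by (simp add: left_diff_distrib)
    with Suc show ?case by simp
  qed simp
  have meas: "?F \<in> borel_measurable ?P"
  proof -
    have mc: "(\<lambda>x. complex_of_real (x i)) \<in> borel_measurable ?P" if "i \<in> {1..Suc n}" for i
      using borel_measurable_arc_component[OF that] by simp
    have E: "(\<lambda>x. exp (f x)) \<in> borel_measurable ?P" if "f \<in> borel_measurable ?P" for f :: "_ \<Rightarrow> complex"
      using that by (rule measurable_compose) (intro borel_measurable_continuous_onI continuous_intros)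
    show ?thesis
      unfolding char_poly_Z_def
      by (intro borel_measurable_prod borel_measurable_diff borel_measurable_times borel_measurable_add borel_measurable_const E mc) auto
  qed
  \<comment> \<open>Prepares Fubini: \<open>?F\<close> and the density are bounded, and constants
    are integrable over a finite product of finite measures.\<close>
  have "integrable ?P ?G"
  proof -
    have one: "integrable ?P (\<lambda>x. \<Prod>r\<in>{1..Suc n}. (1::real))"
      by (rule arcs.product_integrable_prod) auto
    define K where "K = cmod (\<Prod>r=1..k. 1 - e r) * (\<Prod>l<n. \<Prod>r=1..k. 1 + cmod (e r))"
    have F: "cmod (?F x) \<le> K" for x
    proof -
      have "cmod (\<Prod>l<n. \<Prod>r=1..k. 1 - e r * w (x (Suc n)) (x (Suc l))) \<le> (\<Prod>l<n. \<Prod>r=1..k. 1 + cmod (e r))"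
        unfolding prod_norm[symmetric]
        by (intro prod_mono conjI prod_nonneg norm_ge_zero order_trans[OF norm_triangle_ineq4]) (auto simp: norm_mult w_def)
      thus ?thesis unfolding F_eq K_def norm_mult by (rule mult_left_mono) simp
    qed
    define L where "L = (1 / (fact (Suc n) * (2 * pi) ^ Suc n)) * (\<Prod>l\<in>{1..Suc n}. \<Prod>j\<in>{1..<l}. (2::real)\<^sup>2)"
    have W: "0 \<le> weyl_density (Suc n) x \<and> weyl_density (Suc n) x \<le> L" for x
    proof -
      have d: "cmod (exp (\<i> * of_real s) - exp (\<i> * of_real t)) \<le> 2" for s t :: real
        using norm_triangle_ineq4[of "exp (\<i> * of_real s)" "exp (\<i> * of_real t)"] by simp
      show ?thesis
        unfolding weyl_density_def L_def
        by (intro conjI mult_nonneg_nonneg prod_nonneg mult_left_mono prod_mono power_mono d) auto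
    qed
    show ?thesis
    proof (rule Bochner_Integration.integrable_bound)
      show "integrable ?P (\<lambda>x. L * K * (\<Prod>r\<in>{1..Suc n}. (1::real)))"
        using one by (rule integrable_mult_right)
      show "?G \<in> borel_measurable ?P"
        by (intro borel_measurable_scaleR borel_measurable_weyl_density meas)
      have "norm (?G x) \<le> L * K" for x
        unfolding norm_scaleR using W[of x] F[of x] by (intro mult_mono) auto
      moreover have "L * K \<ge> 0"
        by (rule order_trans[OF norm_ge_zero calculation])
      ultimately show "AE x in ?P. norm (?G x) \<le> norm (L * K * (\<Prod>r\<in>{1..Suc n}. (1::real)))"
        by (intro AE_I2) simp
    qed
  qed
  hence intG: "integrable (PiM ({Suc n} \<union> {1..n}) (\<lambda>_. arc_measure)) ?G"
    by (simp add: atLeastAtMostSuc_conv)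
  have W0: "0 \<le> weyl_density (Suc n) x" for x
    unfolding weyl_density_def by (intro mult_nonneg_nonneg prod_nonneg) auto
  have "haar_expectation (Suc n) ?F = (LINT \<theta>|?P. ?G \<theta>)"
    unfolding haar_expectation_def eigenphase_measure_def
    by (rule integral_density[OF meas borel_measurable_weyl_density]) (simp add: W0)
  also have "\<dots> = (LINT \<theta>|PiM ({Suc n} \<union> {1..n}) (\<lambda>_. arc_measure). ?G \<theta>)"
    by (simp add: atLeastAtMostSuc_conv)
  \<comment> \<open>Fubini with the last phase outermost, so that it is fixed while the others are
    integrated.\<close>
  also have "\<dots> = (LINT x|PiM {Suc n} (\<lambda>_. arc_measure). LINT y|PiM {1..n} (\<lambda>_. arc_measure). ?G (merge {Suc n} {1..n} (x, y)))"
    by (rule arcs.product_integral_fold[OF _ _ _ intG]) auto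
  also have "\<dots> = (LINT x|PiM {Suc n} (\<lambda>_. arc_measure). (\<lambda>_. C * (fact n * (2 * of_real pi) ^ n * fps_nth S n)) (x (Suc n)))"
  proof (intro Bochner_Integration.integral_cong refl)
    fix x :: "nat \<Rightarrow> real"
    have m: "merge {Suc n} {1..n} (x, y) (Suc n) = x (Suc n)" for y :: "nat \<Rightarrow> real" by (simp add: merge_def)
    have m': "merge {Suc n} {1..n} (x, y) (Suc l) = y (Suc l)" if "l < n" for y :: "nat \<Rightarrow> real" and l using that by (simp add: merge_def)
    have "?G (merge {Suc n} {1..n} (x, y)) = C * ((\<Prod>l<n. poly q (w (x (Suc n)) (y (Suc l))) * (1 - inverse (w (x (Suc n)) (y (Suc l)))))
       * det (mat n n (\<lambda>(l, i). inverse (w (x (Suc n)) (y (Suc l))) ^ i)) * det (mat n n (\<lambda>(l, i). w (x (Suc n)) (y (Suc l)) ^ i)))" for y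
      unfolding G unfolding m by (intro arg_cong2[of _ _ _ _ "(*)"] refl prod.cong arg_cong[of _ _ det] eq_matI) (auto simp: m')
    hence "(LINT y|PiM {1..n} (\<lambda>_. arc_measure). ?G (merge {Suc n} {1..n} (x, y))) =
       (LINT y|PiM {1..n} (\<lambda>_. arc_measure). C * ((\<Prod>l<n. poly q (w (x (Suc n)) (y (Suc l))) * (1 - inverse (w (x (Suc n)) (y (Suc l)))))
       * det (mat n n (\<lambda>(l, i). inverse (w (x (Suc n)) (y (Suc l))) ^ i)) * det (mat n n (\<lambda>(l, i). w (x (Suc n)) (y (Suc l)) ^ i))))"
      by presburger
    also have "\<dots> = C * (fact n * (2 * of_real pi) ^ n * fps_nth S n)"
      unfolding integral_mult_right_zero w_def toeplitz_integral[OF qS q0] sumS ..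
    finally show "(LINT y|PiM {1..n} (\<lambda>_. arc_measure). ?G (merge {Suc n} {1..n} (x, y))) =
        (\<lambda>_. C * (fact n * (2 * of_real pi) ^ n * fps_nth S n)) (x (Suc n))" .
  qed
  also have "\<dots> = (LINT \<theta>|arc_measure. C * (fact n * (2 * of_real pi) ^ n * fps_nth S n))"
    by (rule arcs.product_integral_singleton) simp
  \<comment> \<open>The total mass of the arc is read off as the Fourier mode 0.\<close>
  also have "\<dots> = C * (fact n * (2 * of_real pi) ^ n * fps_nth S n) * (LINT \<theta>|arc_measure. exp (\<i> * of_int 0 * of_real (\<theta> - 0)))"
    by (subst integral_mult_right_zero[symmetric]) simp
  also have "\<dots> = 1 / of_nat (Suc n) * (\<Prod>r=1..k. 1 - e r) * fps_nth S n"
  proof -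
    have "1 / (N * f * (z * z ^ n)) * P * (f * z ^ n * s) * z = 1 / N * P * s" if "z \<noteq> 0" "f \<noteq> 0" for N f z P s :: complex
      using that by (simp add: field_simps)
    thus ?thesis
      unfolding integral_arc_exp C_def fact_Suc power_Suc by simp
  qed
  finally show ?thesis by (simp add: S_def)
qed

section \<open>The scaling limit\<close>

text \<open>Tannery's theorem becomes uniform when applied along a sequence of points at which the
  error is at least \<open>e\<close> whenever such points exist.\<close>

lemma uniform_limit_suminf_dominated:
  fixes f :: "nat \<Rightarrow> nat \<Rightarrow> 'a \<Rightarrow> 'b::{real_normed_algebra, banach}"
  assumes lim: "\<And>m. uniform_limit A (\<lambda>n. f n m) (g m) sequentially"
    and bound: "\<And>n m a. a \<in> A \<Longrightarrow> norm (f n m a) \<le> M m"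
    and M: "summable M"
  shows "\<forall>a\<in>A. summable (\<lambda>m. g m a)"
    and "uniform_limit A (\<lambda>n a. \<Sum>m. f n m a) (\<lambda>a. \<Sum>m. g m a) sequentially"
proof -
  have bound': "norm (g m a) \<le> M m" if "a \<in> A" for m a
  proof (rule Lim_bounded)
    show "(\<lambda>n. norm (f n m a)) \<longlonglongrightarrow> norm (g m a)"
      using tendsto_uniform_limitI[OF lim that] by (rule tendsto_norm)
    show "\<forall>n\<ge>0. norm (f n m a) \<le> M m" using bound[OF that] by blast
  qed
  have sf: "summable (\<lambda>m. f n m a)" if "a \<in> A" for n a
    by (rule summable_comparison_test'[OF M]) (use bound that in auto)
  have sg: "summable (\<lambda>m. g m a)" if "a \<in> A" for a
    by (rule summable_comparison_test'[OF M]) (use bound' that in auto)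
  thus "\<forall>a\<in>A. summable (\<lambda>m. g m a)" by blast
  show "uniform_limit A (\<lambda>n a. \<Sum>m. f n m a) (\<lambda>a. \<Sum>m. g m a) sequentially"
  proof (cases "A = {}", simp, rule uniform_limitI)
    fix e :: real assume "A \<noteq> {}" and e: "e > 0"
    define bad where "bad n a \<longleftrightarrow> a \<in> A \<and> \<not> dist (\<Sum>m. f n m a) (\<Sum>m. g m a) < e" for n a
    \<comment> \<open>\<open>s n\<close> violates the \<open>e\<close>-bound if any point of
      \<open>A\<close> does. Otherwise it is arbitrary and may lie outside \<open>A\<close>, hence
      the default 0 in \<open>d\<close>.\<close>
    define s where "s n = (SOME a. bad n a)" for n
    define d where "d m n = (if s n \<in> A then f n m (s n) - g m (s n) else 0)" for m n
    \<comment> \<open>The point \<open>s n\<close> moves with \<open>n\<close>, so this rests on the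
      uniformity of each termwise limit.\<close>
    have d0: "d m \<longlonglongrightarrow> 0" for m
    proof (rule tendstoI)
      fix r :: real assume "r > 0"
      from uniform_limitD[OF lim this] show "\<forall>\<^sub>F n in sequentially. dist (d m n) 0 < r"
        by eventually_elim (auto simp: d_def dist_norm \<open>r > 0\<close>)
    qed
    have Mpos: "0 \<le> M m" for m
      using bound' \<open>A \<noteq> {}\<close> norm_ge_zero order_trans by blast
    have "norm (d m n) \<le> 2 * M m" for m n
    proof (cases "s n \<in> A")
      case True
      have "norm (d m n) \<le> norm (f n m (s n)) + norm (g m (s n))"
        using True by (simp add: d_def norm_triangle_ineq4)
      with bound[OF True, of n m] bound'[OF True, of m] show ?thesis by linarith
    qed (simp add: d_def Mpos)
    hence ev: "\<forall>\<^sub>F (m, n) in at_top \<times>\<^sub>F sequentially. norm (d m n) \<le> 2 * M m"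
      by (intro always_eventually) auto
    have "(\<lambda>n. \<Sum>m. d m n) \<longlonglongrightarrow> (\<Sum>m. 0)"
      using tannerys_theorem[OF d0 ev] M by (auto intro: summable_mult)
    hence "\<forall>\<^sub>F n in sequentially. norm (\<Sum>m. d m n) < e"
      using e by (auto simp: tendsto_iff dist_norm)
    thus "\<forall>\<^sub>F n in sequentially. \<forall>a\<in>A. dist (\<Sum>m. f n m a) (\<Sum>m. g m a) < e"
    proof eventually_elim
      case (elim n)
      show ?case
      proof (rule ccontr)
        assume "\<not> ?case"
        then obtain a where "bad n a" unfolding bad_def by blast
        hence "bad n (s n)" unfolding s_def by (rule someI)
        hence "s n \<in> A" and b: "\<not> dist (\<Sum>m. f n m (s n)) (\<Sum>m. g m (s n)) < e"
          by (auto simp: bad_def)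
        have "(\<Sum>m. d m n) = (\<Sum>m. f n m (s n)) - (\<Sum>m. g m (s n))"
          using suminf_diff[OF sf[OF \<open>s n \<in> A\<close>] sg[OF \<open>s n \<in> A\<close>]] \<open>s n \<in> A\<close>
          by (simp add: d_def)
        with elim b show False by (simp add: dist_norm)
      qed
    qed
  qed
qed

text \<open>Double induction along the recurrence; the product in it converges uniformly because the
  limit functions are bounded on \<open>A\<close>.\<close>

lemma uniform_limit_complete_homogeneous:
  assumes lim: "\<And>r. r \<in> {1..k} \<Longrightarrow> uniform_limit A (\<lambda>n a. y n a r) (\<lambda>a. x a r) F"
    and bounded: "\<And>r a. r \<in> {1..k} \<Longrightarrow> a \<in> A \<Longrightarrow> cmod (x a r) \<le> R" and "R \<ge> 0"
  shows "uniform_limit A (\<lambda>n a. complete_homogeneous m k (y n a)) (\<lambda>a. complete_homogeneous m k (x a)) F"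
  using lim bounded
proof (induction k arbitrary: m)
  case 0
  show ?case
    by (cases m) (simp_all add: complete_homogeneous_0_right uniform_limit_const)
next
  case (Suc k)
  note IHk = Suc.IH and lim = Suc.prems(1) and bounded = Suc.prems(2)
  show ?case
  proof (induction m)
    case 0
    show ?case by (simp add: uniform_limit_const)
  next
    case (Suc m)
    have b1: "bounded ((\<lambda>a. x a (Suc k)) ` A)"
      using bounded by (auto simp: bounded_iff intro!: exI[of _ R])
    have b2: "bounded ((\<lambda>a. complete_homogeneous m (Suc k) (x a)) ` A)"
      using norm_complete_homogeneous_le[of "Suc k" _ R m] bounded \<open>R \<ge> 0\<close>
      by (auto simp: bounded_iff intro!: exI[of _ "2 ^ (m + Suc k) * R ^ m"])
    have "uniform_limit A (\<lambda>n a. y n a (Suc k) * complete_homogeneous m (Suc k) (y n a))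
             (\<lambda>a. x a (Suc k) * complete_homogeneous m (Suc k) (x a)) F"
      by (rule bounded_bilinear.bounded_uniform_limit[OF bounded_bilinear_mult lim Suc.IH b2 b1]) simp
    moreover have "uniform_limit A (\<lambda>n a. complete_homogeneous (Suc m) k (y n a)) (\<lambda>a. complete_homogeneous (Suc m) k (x a)) F"
      using lim bounded by (intro IHk) auto
    ultimately show ?case
      unfolding complete_homogeneous_Suc_Suc by (intro uniform_limit_add)
  qed
qed

text \<open>Boundedness of the limit is part of the conclusion because the induction step multiplies
  two uniform limits and asks for it on both.\<close>

lemma uniform_limit_prod_bounded:
  fixes x :: "'a \<Rightarrow> 'b \<Rightarrow> 'c::{real_normed_field}"
  assumes "finite I"
    and lim: "\<And>r. r \<in> I \<Longrightarrow> uniform_limit A (\<lambda>n a. y n a r) (\<lambda>a. x a r) F"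
    and bounded: "\<And>r. r \<in> I \<Longrightarrow> bounded ((\<lambda>a. x a r) ` A)"
  shows "uniform_limit A (\<lambda>n a. \<Prod>r\<in>I. y n a r) (\<lambda>a. \<Prod>r\<in>I. x a r) F \<and> bounded ((\<lambda>a. \<Prod>r\<in>I. x a r) ` A)"
  using assms
proof (induction I rule: finite_induct)
  case empty
  show ?case by (auto simp: uniform_limit_const bounded_iff)
next
  case (insert i I)
  have b: "bounded ((\<lambda>a. x a i) ` A)" and c: "bounded ((\<lambda>a. \<Prod>r\<in>I. x a r) ` A)"
    and l: "uniform_limit A (\<lambda>n a. \<Prod>r\<in>I. y n a r) (\<lambda>a. \<Prod>r\<in>I. x a r) F"
    using insert by auto
  from b c obtain B C where B: "\<And>a. a \<in> A \<Longrightarrow> norm (x a i) \<le> B" and C: "\<And>a. a \<in> A \<Longrightarrow> norm (\<Prod>r\<in>I. x a r) \<le> C"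
    unfolding bounded_iff by auto
  have "norm (x a i * (\<Prod>r\<in>I. x a r)) \<le> B * C" if "a \<in> A" for a
    unfolding norm_mult using B[OF that] C[OF that] order_trans[OF norm_ge_zero B[OF that]]
    by (intro mult_mono) auto
  moreover have "uniform_limit A (\<lambda>n a. y n a i * (\<Prod>r\<in>I. y n a r)) (\<lambda>a. x a i * (\<Prod>r\<in>I. x a r)) F"
    by (rule bounded_bilinear.bounded_uniform_limit[OF bounded_bilinear_mult insert.prems(1) l c b]) simp
  ultimately show ?case using insert.hyps by (auto simp: bounded_iff intro!: exI[of _ "B * C"])
qed

section \<open>Estimates for the rescaled exponentials and binomials\<close>

lemma norm_scaled_exp_minus_one_le:
  assumes "cmod a \<le> R"
  shows "cmod (of_nat n * (exp (a / of_nat n) - 1)) \<le> R * exp R"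
proof (cases "n = 0")
  case True
  thus ?thesis using order_trans[OF norm_ge_zero assms] by simp
next
  case False
  have R: "0 \<le> R" using order_trans[OF norm_ge_zero assms] .
  have "cmod (a / of_nat n) \<le> cmod a" using False
    by (simp add: norm_divide divide_le_eq mult_le_cancel_left1)
  hence "exp (cmod (a / of_nat n)) \<le> exp R" using assms by simp
  moreover have "cmod (exp (a / of_nat n) - 1) \<le> exp (cmod (a / of_nat n)) * cmod (a / of_nat n)"
    using Taylor_exp_field[of "a / of_nat n" 0] by simp
  ultimately have "cmod (exp (a / of_nat n) - 1) \<le> exp R * cmod (a / of_nat n)"
    by (meson mult_right_mono norm_ge_zero order_trans)
  hence "real n * cmod (exp (a / of_nat n) - 1) \<le> exp R * cmod a"
    using False by (simp add: norm_divide field_simps)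
  also have "\<dots> \<le> R * exp R" using assms by simp
  finally show ?thesis by (simp add: norm_mult)
qed

text \<open>The Taylor remainder after the linear term, multiplied by \<open>n\<close>, is at most
  \<open>exp R * R\<^sup>2 / n\<close> uniformly on \<open>A\<close>.\<close>

lemma uniform_limit_scaled_exp_minus_one:
  assumes "\<And>a. a \<in> A \<Longrightarrow> cmod (f a) \<le> R"
  shows "uniform_limit A (\<lambda>n a. of_nat n * (exp (f a / of_nat n) - 1)) f sequentially"
proof (rule uniform_limitI)
  fix e :: real assume "e > 0"
  have "(\<lambda>n. exp R * R\<^sup>2 * inverse (real n)) \<longlonglongrightarrow> exp R * R\<^sup>2 * 0"
    by (intro tendsto_intros lim_inverse_n)
  hence "\<forall>\<^sub>F n in sequentially. exp R * R\<^sup>2 * inverse (real n) < e"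
    using \<open>e > 0\<close> by (auto dest: order_tendstoD)
  thus "\<forall>\<^sub>F n in sequentially. \<forall>a\<in>A. dist (of_nat n * (exp (f a / of_nat n) - 1)) (f a) < e"
    using eventually_gt_at_top[of 0]
  proof eventually_elim
    case (elim n)
    show ?case
    proof
      fix a assume a: "a \<in> A"
      have aR: "cmod (f a) \<le> R" using assms[OF a] .
      have "cmod (f a / of_nat n) \<le> cmod (f a)" using elim
        by (simp add: norm_divide divide_le_eq mult_le_cancel_left1)
      hence ex: "exp (cmod (f a / of_nat n)) \<le> exp R" using aR by simp
      have "cmod (exp (f a / of_nat n) - (1 + f a / of_nat n)) \<le> exp (cmod (f a / of_nat n)) * (cmod (f a / of_nat n))\<^sup>2"
        using Taylor_exp_field[of "f a / of_nat n" 1] by (simp add: power2_eq_square)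
      also have "\<dots> \<le> exp R * (R / real n)\<^sup>2"
        using ex aR elim by (intro mult_mono power_mono) (auto simp: norm_divide divide_right_mono)
      finally have "real n * cmod (exp (f a / of_nat n) - (1 + f a / of_nat n)) \<le> real n * (exp R * (R / real n)\<^sup>2)"
        by (intro mult_left_mono) auto
      also have "\<dots> = exp R * R\<^sup>2 * inverse (real n)"
        using elim by (simp add: power2_eq_square field_simps)
      also have "real n * cmod (exp (f a / of_nat n) - (1 + f a / of_nat n)) =
          cmod (of_nat n * (exp (f a / of_nat n) - (1 + f a / of_nat n)))"
        by (simp add: norm_mult)
      also have "of_nat n * (exp (f a / of_nat n) - (1 + f a / of_nat n)) = of_nat n * (exp (f a / of_nat n) - 1) - f a"
        using elim by (simp add: field_simps)
      finally show "dist (of_nat n * (exp (f a / of_nat n) - 1)) (f a) < e"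
        using elim by (simp add: dist_norm)
    qed
  qed
qed

text \<open>The binomial is a falling factorial over \<open>fact p\<close>; after division by
  \<open>n ^ p\<close>, each of its \<open>p\<close> factors tends to 1.\<close>

lemma binomial_over_power_tendsto:
  "(\<lambda>n. real ((n + k) choose p) / real n ^ p) \<longlonglongrightarrow> 1 / fact p"
proof -
  have "(\<lambda>n. (\<Prod>i<p. 1 + (real k - real i) * inverse (real n)) / fact p) \<longlonglongrightarrow> (\<Prod>i<p. 1 + (real k - real i) * 0) / fact p"
    by (intro tendsto_intros lim_inverse_n) auto
  moreover have "\<forall>\<^sub>F n in sequentially. (\<Prod>i<p. 1 + (real k - real i) * inverse (real n)) / fact p = real ((n + k) choose p) / real n ^ p"
    using eventually_gt_at_top[of 0]
  proof eventually_elim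
    case (elim n)
    have "real ((n + k) choose p) = (\<Prod>i<p. real n + real k - real i) / fact p"
      by (simp add: binomial_gbinomial gbinomial_prod_rev lessThan_atLeast0)
    also have "(\<Prod>i<p. real n + real k - real i) = (\<Prod>i<p. real n * (1 + (real k - real i) * inverse (real n)))"
      using elim by (intro prod.cong) (auto simp: field_simps)
    finally show ?case using elim by (simp add: prod.distrib)
  qed
  ultimately show ?thesis by (simp add: filterlim_cong[OF refl refl])
qed

text \<open>A falling factorial is at most \<open>(n + k) ^ p\<close>, and
  \<open>n + k \<le> (k + 1) * n\<close> for positive \<open>n\<close>. At \<open>n = 0\<close>
  division by zero yields 0 unless \<open>p = 0\<close>.\<close>

lemma binomial_over_power_le:
  "real ((n + k) choose p) / real n ^ p \<le> real (k + 1) ^ p / fact p"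
proof (cases "n = 0")
  case True
  thus ?thesis by (cases p) auto
next
  case False
  have "real ((n + k) choose p) * fact p \<le> real (n + k) ^ p"
    using of_nat_mono[OF binomial_fact_pow[of "n + k" p], where 'a = real] by simp
  also have "\<dots> \<le> (real (k + 1) * real n) ^ p"
    using False by (intro power_mono) (simp_all add: algebra_simps mult_le_cancel_left1)
  also have "\<dots> = real (k + 1) ^ p * real n ^ p" by (rule power_mult_distrib)
  finally show ?thesis using False by (simp add: divide_le_eq le_divide_eq)
qed

text \<open>Since \<open>Y\<close> tends to \<open>- \<i> * a\<close>, the polynomials contribute
  \<open>(- \<i>) ^ m\<close> and the product \<open>\<i> ^ k\<close>; the binomials give the
  reciprocal factorial. A dominating exponential series lets the limit pass through the sum.\<close>

lemma scaling_limit: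
  fixes A :: "(nat \<Rightarrow> complex) set" and k :: nat
  assumes "\<And>r. r \<in> {1..k} \<Longrightarrow> bounded ((\<lambda>a. a r) ` A)"
  defines "Y \<equiv> \<lambda>N a r. of_nat N * (exp (- \<i> * a r / of_nat N) - 1)"
  defines "g \<equiv> \<lambda>m a. (-1) ^ m * \<i> ^ (k + m) / fact (m + k + 1) * complete_homogeneous m k a * (\<Prod>j=1..k. a j)"
  shows "\<forall>a\<in>A. summable (\<lambda>m. g m a)"
    and "uniform_limit A
      (\<lambda>N a. \<Sum>m. of_nat ((N + k) choose (m + k + 1)) / of_nat N ^ (m + k + 1)
          * complete_homogeneous m k (Y N a) * (\<Prod>r=1..k. - Y N a r))
      (\<lambda>a. \<Sum>m. g m a) sequentially"
proof -
  have "bounded (\<Union>r\<in>{1..k}. (\<lambda>a. a r) ` A)"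
    using assms(1) by (intro bounded_UN) auto
  then obtain R0 where R0: "\<And>a r. a \<in> A \<Longrightarrow> r \<in> {1..k} \<Longrightarrow> cmod (a r) \<le> R0"
    unfolding bounded_iff by blast
  \<comment> \<open>\<open>R0\<close> may be negative, for instance when \<open>A\<close> is empty,
    whence the maximum.\<close>
  define R where "R = max R0 0"
  have R: "R \<ge> 0" "\<And>a r. a \<in> A \<Longrightarrow> r \<in> {1..k} \<Longrightarrow> cmod (a r) \<le> R"
    using R0 by (auto simp: R_def max.coboundedI1)
  define B where "B = R * exp R"
  have B: "B \<ge> 0" using R by (simp add: B_def)
  have YB: "cmod (Y N a r) \<le> B" if "a \<in> A" "r \<in> {1..k}" for N a r
    unfolding Y_def B_def by (rule norm_scaled_exp_minus_one_le) (simp add: norm_mult R(2)[OF that])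
  have Ylim: "uniform_limit A (\<lambda>N a. Y N a r) (\<lambda>a. - \<i> * a r) sequentially" if "r \<in> {1..k}" for r
    unfolding Y_def by (rule uniform_limit_scaled_exp_minus_one[where R = R]) (simp add: norm_mult R(2)[OF _ that])
  define c where "c N m = real ((N + k) choose (m + k + 1)) / real N ^ (m + k + 1)" for N m
  define f where "f N m a = of_real (c N m) * (complete_homogeneous m k (Y N a) * (\<Prod>r=1..k. - Y N a r))" for N m a
  have g_eq: "g m a = of_real (1 / fact (m + k + 1)) * (complete_homogeneous m k (\<lambda>r. - \<i> * a r) * (\<Prod>r=1..k. \<i> * a r))" for m a
  proof -
    have "(- \<i>) ^ m = (-1) ^ m * \<i> ^ m" by (rule power_minus)
    thus ?thesis unfolding g_def complete_homogeneous_scale prod.distrib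
      by (simp add: power_add)
  qed
  \<comment> \<open>Multiplies the bounds for the three factors of \<open>f\<close>, with
    \<open>fact (m + k + 1)\<close> weakened to \<open>fact m\<close> so that an exponential series
    appears.\<close>
  define M where "M m = real (k + 1) ^ (k + 1) * 2 ^ k * B ^ k * (inverse (fact m) * (2 * real (k + 1) * B) ^ m)" for m
  have sM: "summable M"
    unfolding M_def by (intro summable_mult summable_exp)
  have fM: "cmod (f N m a) \<le> M m" if a: "a \<in> A" for N m a
  proof -
    have 1: "cmod (complete_homogeneous m k (Y N a)) \<le> 2 ^ (m + k) * B ^ m"
      using YB[OF a] B by (intro norm_complete_homogeneous_le) auto
    have 2: "cmod (\<Prod>r=1..k. - Y N a r) \<le> B ^ k"
    proof -
      have "(\<Prod>r=1..k. cmod (Y N a r)) \<le> (\<Prod>r=1..k. B)"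
        using YB[OF a] by (intro prod_mono) auto
      thus ?thesis by (simp add: prod_norm[symmetric])
    qed
    have "c N m \<le> real (k + 1) ^ (m + k + 1) / fact (m + k + 1)"
      unfolding c_def by (rule binomial_over_power_le)
    also have "\<dots> \<le> real (k + 1) ^ (m + k + 1) / fact m"
      by (intro divide_left_mono fact_mono) auto
    finally have 3: "c N m \<le> real (k + 1) ^ (m + k + 1) / fact m" .
    have "cmod (f N m a) = c N m * (cmod (complete_homogeneous m k (Y N a)) * cmod (\<Prod>r=1..k. - Y N a r))"
      unfolding f_def norm_mult norm_of_real by (simp add: c_def)
    also have "\<dots> \<le> real (k + 1) ^ (m + k + 1) / fact m * ((2 ^ (m + k) * B ^ m) * B ^ k)"
      using 1 2 3 B by (intro mult_mono) auto
    also have "\<dots> = M m"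
      by (simp only: M_def power_add power_mult_distrib divide_inverse mult_ac)
    finally show ?thesis .
  qed
  have fg: "uniform_limit A (\<lambda>N. f N m) (g m) sequentially" for m
  proof -
    have b1: "bounded ((\<lambda>a. - \<i> * a r) ` A)" "bounded ((\<lambda>a. \<i> * a r) ` A)" if "r \<in> {1..k}" for r
      using R(2) that by (auto simp: bounded_iff norm_mult intro!: exI[of _ R])
    have h: "uniform_limit A (\<lambda>N a. complete_homogeneous m k (Y N a)) (\<lambda>a. complete_homogeneous m k (\<lambda>r. - \<i> * a r)) sequentially"
      by (rule uniform_limit_complete_homogeneous[where R = R]) (use Ylim R in \<open>auto simp: norm_mult\<close>)
    have hb: "bounded ((\<lambda>a. complete_homogeneous m k (\<lambda>r. - \<i> * a r)) ` A)"
    proof -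
      have "cmod (complete_homogeneous m k (\<lambda>r. - \<i> * a r)) \<le> 2 ^ (m + k) * R ^ m" if "a \<in> A" for a
        using R that by (intro norm_complete_homogeneous_le) (auto simp: norm_mult)
      thus ?thesis unfolding bounded_iff by blast
    qed
    have p: "uniform_limit A (\<lambda>N a. \<Prod>r=1..k. - Y N a r) (\<lambda>a. \<Prod>r=1..k. \<i> * a r) sequentially \<and>
         bounded ((\<lambda>a. \<Prod>r=1..k. \<i> * a r) ` A)"
    proof (rule uniform_limit_prod_bounded)
      fix r assume r: "r \<in> {1..k}"
      show "uniform_limit A (\<lambda>N a. - Y N a r) (\<lambda>a. \<i> * a r) sequentially"
        using uniform_limit_uminus[OF Ylim[OF r]] by simp
    qed (use b1 in auto)
    have hp: "uniform_limit A (\<lambda>N a. complete_homogeneous m k (Y N a) * (\<Prod>r=1..k. - Y N a r))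
       (\<lambda>a. complete_homogeneous m k (\<lambda>r. - \<i> * a r) * (\<Prod>r=1..k. \<i> * a r)) sequentially"
      by (rule bounded_bilinear.bounded_uniform_limit[OF bounded_bilinear_mult h _ _ hb]) (use p in auto)
    have hpb: "bounded ((\<lambda>a. complete_homogeneous m k (\<lambda>r. - \<i> * a r) * (\<Prod>r=1..k. \<i> * a r)) ` A)"
    proof -
      obtain C D where "\<And>a. a \<in> A \<Longrightarrow> cmod (complete_homogeneous m k (\<lambda>r. - \<i> * a r)) \<le> C"
        and "\<And>a. a \<in> A \<Longrightarrow> cmod (\<Prod>r=1..k. \<i> * a r) \<le> D"
        using hb p unfolding bounded_iff by auto
      hence "cmod (complete_homogeneous m k (\<lambda>r. - \<i> * a r) * (\<Prod>r=1..k. \<i> * a r)) \<le> C * D" if "a \<in> A" for a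
        unfolding norm_mult using that by (intro mult_mono) (auto intro: order_trans[OF norm_ge_zero])
      thus ?thesis unfolding bounded_iff by blast
    qed
    have cl: "uniform_limit A (\<lambda>N a. complex_of_real (c N m)) (\<lambda>a. of_real (1 / fact (m + k + 1))) sequentially"
    proof -
      have "(\<lambda>N. complex_of_real (c N m)) \<longlonglongrightarrow> of_real (1 / fact (m + k + 1))"
        unfolding c_def by (intro tendsto_of_real binomial_over_power_tendsto)
      thus ?thesis by (auto simp: uniform_limit_iff tendsto_iff elim!: eventually_mono)
    qed
    have "uniform_limit A (\<lambda>N a. f N m a) (\<lambda>a. g m a) sequentially"
      unfolding f_def g_eq
      by (rule bounded_bilinear.bounded_uniform_limit[OF bounded_bilinear_mult cl hp hpb])
        (auto simp: bounded_iff)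
    thus ?thesis by simp
  qed
  note main = uniform_limit_suminf_dominated[where A = A and f = f and g = g, OF fg fM sM]
  show "\<forall>a\<in>A. summable (\<lambda>m. g m a)" using main(1) .
  have "f N m a = of_nat ((N + k) choose (m + k + 1)) / of_nat N ^ (m + k + 1)
          * complete_homogeneous m k (Y N a) * (\<Prod>r=1..k. - Y N a r)" for N m a
    by (simp add: f_def c_def)
  with main(2) show "uniform_limit A
      (\<lambda>N a. \<Sum>m. of_nat ((N + k) choose (m + k + 1)) / of_nat N ^ (m + k + 1)
          * complete_homogeneous m k (Y N a) * (\<Prod>r=1..k. - Y N a r))
      (\<lambda>a. \<Sum>m. g m a) sequentially" by simp
qed

text \<open>Bounded sets of \<open>k\<close>-tuples are encoded as sets \<open>A\<close> of
  functions bounded in each of the coordinates \<open>1\<close> to \<open>k\<close>. Summability is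
  asserted separately because \<open>suminf\<close> denotes a value even for divergent
  series.\<close>

theorem theorem4:
  fixes k :: nat and A :: "(nat \<Rightarrow> complex) set"
  assumes "k \<ge> 1"
    and "\<And>r. r \<in> {1..k} \<Longrightarrow> bounded ((\<lambda>a. a r) ` A)"
  shows "(\<forall>a\<in>A. summable (\<lambda>m. (-1) ^ m * \<i> ^ (k + m) / fact (m + k + 1)
                    * complete_homogeneous m k a * (\<Prod>j=1..k. a j))) \<and>
    uniform_limit A
      (\<lambda>N a. haar_expectation N
         (\<lambda>\<theta>. \<Prod>r=1..k. char_poly_Z N \<theta> (of_real (\<theta> N) + a r / of_nat N)))
      (\<lambda>a. \<Sum>m. (-1) ^ m * \<i> ^ (k + m) / fact (m + k + 1)
                    * complete_homogeneous m k a * (\<Prod>j=1..k. a j))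
      sequentially"
proof -
  define Y where "Y N a r = of_nat N * (exp (- \<i> * a r / of_nat N) - 1)" for N :: nat and a :: "nat \<Rightarrow> complex" and r
  \<comment> \<open>At positive \<open>N\<close> the expectation equals the series of
    \<open>scaling_limit\<close> exactly, without an error term.\<close>
  have exact: "haar_expectation N (\<lambda>\<theta>. \<Prod>r=1..k. char_poly_Z N \<theta> (of_real (\<theta> N) + a r / of_nat N)) =
      (\<Sum>m. of_nat ((N + k) choose (m + k + 1)) / of_nat N ^ (m + k + 1)
          * complete_homogeneous m k (Y N a) * (\<Prod>r=1..k. - Y N a r))" if "N > 0" for N a
  proof -
    obtain n where N: "N = Suc n" using \<open>N > 0\<close> by (cases N) auto
    let ?e = "\<lambda>r. exp (- \<i> * (a r / of_nat N))"
    have e: "?e r - 1 = inverse (of_nat N) * Y N a r" for r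
      using that by (simp add: Y_def)
    have e': "1 - ?e r = inverse (of_nat N) * (- Y N a r)" for r
      using that by (simp add: Y_def field_simps)
    have "haar_expectation N (\<lambda>\<theta>. \<Prod>r=1..k. char_poly_Z N \<theta> (of_real (\<theta> N) + a r / of_nat N)) =
       1 / of_nat N * (\<Prod>r=1..k. 1 - ?e r)
      * (\<Sum>m\<le>n. of_nat ((n + k + 1) choose (m + k + 1)) * complete_homogeneous m k (\<lambda>r. ?e r - 1))"
      unfolding N by (rule haar_expectation_char_poly_Z)
    \<comment> \<open>In the denominator, homogeneity yields \<open>N ^ m\<close>, the product
      \<open>N ^ k\<close>, and the prefactor one more \<open>N\<close>.\<close>
    also have "\<dots> = (\<Sum>m\<le>n. of_nat ((N + k) choose (m + k + 1)) / of_nat N ^ (m + k + 1)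
          * complete_homogeneous m k (Y N a) * (\<Prod>r=1..k. - Y N a r))"
      unfolding e e' complete_homogeneous_scale prod.distrib sum_distrib_left
      by (intro sum.cong refl) (simp add: N power_add field_simps del: of_nat_Suc binomial_Suc_Suc)
    \<comment> \<open>For \<open>m > n\<close> the lower index exceeds \<open>N + k\<close>, so the
      binomial vanishes and the finite sum is a series.\<close>
    also have "\<dots> = (\<Sum>m. of_nat ((N + k) choose (m + k + 1)) / of_nat N ^ (m + k + 1)
          * complete_homogeneous m k (Y N a) * (\<Prod>r=1..k. - Y N a r))"
      by (rule suminf_finite[symmetric]) (auto simp: N binomial_eq_0 simp del: binomial_Suc_Suc)
    finally show ?thesis .
  qed
  note limit = scaling_limit[of k A, OF assms(2), folded Y_def]
  have "uniform_limit A
      (\<lambda>N a. haar_expectation N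
         (\<lambda>\<theta>. \<Prod>r=1..k. char_poly_Z N \<theta> (of_real (\<theta> N) + a r / of_nat N)))
      (\<lambda>a. \<Sum>m. (-1) ^ m * \<i> ^ (k + m) / fact (m + k + 1)
                    * complete_homogeneous m k a * (\<Prod>j=1..k. a j))
      sequentially"
  proof (rule iffD2[OF uniform_limit_cong limit(2)])
    show "\<forall>\<^sub>F N in sequentially. \<forall>a\<in>A. haar_expectation N
         (\<lambda>\<theta>. \<Prod>r=1..k. char_poly_Z N \<theta> (of_real (\<theta> N) + a r / of_nat N)) =
      (\<Sum>m. of_nat ((N + k) choose (m + k + 1)) / of_nat N ^ (m + k + 1)
          * complete_homogeneous m k (Y N a) * (\<Prod>r=1..k. - Y N a r))"
      using eventually_gt_at_top[of 0] by eventually_elim (use exact in blast)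
  qed simp
  with limit(1) show ?thesis by blast
qed

end
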